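(* Let $G=\mathbb{R}^n$ be a stratified nilpotent Lie group of rank $r$ with Lie algebra $\mathfrak g$, identified with $\mathbb{R}^n$ via exponential coordinates of the second type induced by an adapted basis $X_1,\dots,X_n$ of $\mathfrak g$. Let $\{X_j\}_{j\le n}$ be an extension of it to an adapted basis of the Tanaka prolongation $\mathrm{Prol}(\mathfrak g)$, with structure constants $c_{ij}^k$, and let $P_j^v$ ($j\le n$, $v\in\mathbb{R}^n$) be the associated extremal polynomials. Then for any $v\in\mathbb{R}^n$, any $i=1,\dots,n$, and any $j\in\mathbb{Z}$ with $j\le n$, there holds $$X_i P_j^v=\sum_{k\le n} c_{ij}^k\, P_k^v \quad\text{on } \mathbb{R}^n.$$ Moreover, for each $v\in\mathbb{R}^n$ the family $\{P_j^v\}_{j\le n}$ is uniquely determined by these identities for $i=1,\dots,r$ together with $P_j^v(0)=v_j$ for $j\le n$: that is, the family satisfies $P_j^v(0)=v_j$ for all $j\le n$, and if $\{Q_j\}_{j\le n}$ is any family of polynomials on $\mathbb{R}^n$ with $X_iQ_j=\sum_{k\le n}c_{ij}^kQ_k$ for all $i=1,\dots,r$ and $j\le n$, and $Q_j(0)=v_j$ for all $j\le n$, then $Q_j=P_j^v$ for all $j\le n$. (Here $v_j=0$ for $j\le 0$.)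
   Context: Stratified group. $G$ is a (connected, simply connected) nilpotent Lie group of dimension $n$ whose real Lie algebra of left-invariant vector fields is stratified: $\mathfrak g=\mathfrak g_1\oplus\cdots\oplus\mathfrak g_s$, $\mathfrak g_i=[\mathfrak g_{i-1},\mathfrak g_1]$ for $i=2,\dots,s$, $\mathfrak g_i=\{0\}$ for $i>s$; $s$ is the step and $r=\dim\mathfrak g_1$ the rank. Tanaka prolongation. $\mathfrak g_0$ is the space of linear maps $\phi:\mathfrak g\to\mathfrak g$ with $\phi(\mathfrak g_i)\subset\mathfrak g_i$ for $i=1,\dots,s$ and $\phi([X,Y])=[\phi(X),Y]+[X,\phi(Y)]$ for all $X,Y\in\mathfrak g$. Set $[\phi,X]=-[X,\phi]=\phi(X)$ for $\phi\in\mathfrak g_0$, $X\in\mathfrak g$. Inductively for $k\ge1$, when $\mathfrak g_{1-k},\dots,\mathfrak g_s$ and the brackets $[\phi,X]=\phi(X)$ with $X\in\mathfrak g$ are already defined, $\mathfrak g_{-k}$ is the space of linear maps $\phi:\mathfrak g\to\mathfrak g_{1-k}\oplus\cdots\oplus\mathfrak g_{s-k}$ with $\phi(\mathfrak g_i)\subset\mathfrak g_{i-k}$ for $i=1,\dots,s$ and $\phi([X,Y])=[\phi(X),Y]+[X,\phi(Y)]$ for all $X,Y\in\mathfrak g$; again $[\phi,X]=-[X,\phi]=\phi(X)$ for $X\in\mathfrak g$. For $\phi,\psi$ of degree $\le 0$ the bracket is defined inductively by $[\phi,\psi](X)=[[\phi,X],\psi]+[\phi,[\psi,X]]$, $X\in\mathfrak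 g$. Then $\mathrm{Prol}(\mathfrak g)=\bigoplus_{k\le s}\mathfrak g_k$ is a graded Lie algebra ($[\mathfrak g_i,\mathfrak g_j]\subset\mathfrak g_{i+j}$) with finite-dimensional strata, possibly infinite dimensional. Basis and degrees. $X_1,\dots,X_n$ is a basis of $\mathfrak g$ adapted to the stratification, extended to a basis $\{X_j\}_{j\le n}$ of $\mathrm{Prol}(\mathfrak g)$ indexed by integers $j\le n$ (if $\mathrm{Prol}(\mathfrak g)$ is finite dimensional, by $m\le j\le n$ for some $m\in\mathbb{Z}$; the notation $j\le n$ is still used and always refers to indices in the range). Each $X_j$ lies in some stratum $\mathfrak g_k$; its degree is $d(j)=k$. The basis is adapted: $i<j$ implies $d(i)\le d(j)$. Structure constants: $[X_i,X_j]=\sum_{k\le n}c_{ij}^kX_k$ (a finite sum). Coordinates. $G$ is identified with $\mathbb{R}^n$ by $x=(x_1,\dots,x_n)\leftrightarrow \exp(x_nX_n)\cdot\ldots\cdot\exp(x_1X_1)$, and $X_1,\dots,X_n$ are viewed as left-invariant vector fields on $\mathbb{R}^n$, acting as derivations on functions. Generalized structure constants. For $\alpha\in\mathbb{N}^n=\{0,1,2,\dots\}^n$ and $i\le n$, $[X_i,X_\alpha]$ denotes the left-nested iterated bracket $[\cdots[[X_i,X_1],X_1],\dots,X_n]$ in which, starting from $X_i$, one brackets on the right $\alpha_1$ times with $X_1$, then $\alpha_2$ times with $X_2$, ..., finally $\alpha_n$ times with $X_n$; $[X_i,X_0]=X_i$. The constants $c_{i\alpha}^k$ are defined by $[X_i,X_\alpha]=\sum_{k\le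 n}c_{i\alpha}^kX_k$. Extremal polynomials. For $v=(v_1,\dots,v_n)\in\mathbb{R}^n$, with the convention $v_k=0$ for $k\le0$, and for $i\le n$, $$P_i^v(x)=\sum_{\alpha\in\mathbb{N}^n}\frac{(-1)^{|\alpha|}}{\alpha!}\Big(\sum_{k\le n}c_{i\alpha}^kv_k\Big)x^\alpha,\qquad x\in\mathbb{R}^n,$$ where $|\alpha|=\alpha_1+\cdots+\alpha_n$, $\alpha!=\alpha_1!\cdots\alpha_n!$ (only finitely many terms are nonzero). *)

theory Defs
  imports
    "HOL-Analysis.Analysis"
    "HOL-Algebra.Group"
    "HOL-Library.Function_Algebras"
    "HOL-Library.Groups_Big_Fun"
begin

text \<open>Pointwise real vector space structure on functions: it provides \<^const>\<open>span\<close>,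
  \<^const>\<open>dim\<close> and \<^const>\<open>representation\<close> for vector fields and for elements of the prolongation.\<close>

instantiation "fun" :: (type, real_vector) real_vector
begin

definition scaleR_fun :: "real \<Rightarrow> ('a \<Rightarrow> 'b) \<Rightarrow> 'a \<Rightarrow> 'b"
  where "scaleR_fun c f = (\<lambda>x. c *\<^sub>R f x)"

instance
  by standard (auto simp: scaleR_fun_def fun_eq_iff scaleR_add_right scaleR_add_left)

end


section \<open>Lie groups on Euclidean space\<close>

primrec C_k :: "nat \<Rightarrow> ('a::euclidean_space \<Rightarrow> 'b::euclidean_space) \<Rightarrow> bool"
  where
    "C_k 0 f \<longleftrightarrow> continuous_on UNIV f"
  | "C_k (Suc k) f \<longleftrightarrow>
       (\<forall>x. f differentiable at x) \<and> (\<forall>h. C_k k (\<lambda>x. frechet_derivative f (at x) h))"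

definition smooth :: "('a::euclidean_space \<Rightarrow> 'b::euclidean_space) \<Rightarrow> bool"
  where "smooth f \<longleftrightarrow> (\<forall>k. C_k k f)"

definition lie_group :: "('a::euclidean_space) monoid \<Rightarrow> bool"
  where "lie_group G \<longleftrightarrow> group G \<and> carrier G = UNIV \<and>
     smooth (\<lambda>p. fst p \<otimes>\<^bsub>G\<^esub> snd p) \<and> smooth (\<lambda>x. inv\<^bsub>G\<^esub> x)"

definition vf_apply :: "('a::euclidean_space \<Rightarrow> 'a) \<Rightarrow> ('a \<Rightarrow> real) \<Rightarrow> 'a \<Rightarrow> real"
  where "vf_apply X f x = frechet_derivative f (at x) (X x)"

text \<open>The commutator of derivations, \<open>[X, Y] f = X (Y f) - Y (X f)\<close>, in coordinates.\<close>

definition vf_bracket :: "('a::euclidean_space \<Rightarrow> 'a) \<Rightarrow> ('a \<Rightarrow> 'a) \<Rightarrow> 'a \<Rightarrow> 'a"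
  where "vf_bracket X Y x =
     frechet_derivative Y (at x) (X x) - frechet_derivative X (at x) (Y x)"

definition lie_algebra :: "('a::euclidean_space) monoid \<Rightarrow> ('a \<Rightarrow> 'a) set"
  where "lie_algebra G = {X. smooth X \<and>
     (\<forall>a x. X (a \<otimes>\<^bsub>G\<^esub> x) = frechet_derivative (\<lambda>y. a \<otimes>\<^bsub>G\<^esub> y) (at x) (X x))}"

text \<open>Time-one value of the integral curve of a left-invariant field starting at the unit.\<close>

definition lie_exp :: "('a::euclidean_space) monoid \<Rightarrow> ('a \<Rightarrow> 'a) \<Rightarrow> 'a"
  where "lie_exp G X = (THE p. \<exists>\<gamma>. \<gamma> 0 = \<one>\<^bsub>G\<^esub> \<and>
     (\<forall>t::real. (\<gamma> has_vector_derivative X (\<gamma> t)) (at t)) \<and> p = \<gamma> 1)"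


section \<open>Stratifications and adapted bases\<close>

definition stratification ::
    "'v::real_vector set \<Rightarrow> ('v \<Rightarrow> 'v \<Rightarrow> 'v) \<Rightarrow> (int \<Rightarrow> 'v set) \<Rightarrow> int \<Rightarrow> bool"
  where "stratification L br S s \<longleftrightarrow>
     1 \<le> s \<and> (\<forall>i\<ge>1. subspace (S i)) \<and>
     span (\<Union>i\<in>{1..s}. S i) = L \<and>
     (\<forall>x. (\<forall>i\<in>{1..s}. x i \<in> S i) \<and> (\<Sum>i=1..s. x i) = 0 \<longrightarrow> (\<forall>i\<in>{1..s}. x i = 0)) \<and>
     (\<forall>i\<ge>2. S i = span {br X Y | X Y. X \<in> S (i - 1) \<and> Y \<in> S 1}) \<and>
     S s \<noteq> {0} \<and> (\<forall>i>s. S i = {0})"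

text \<open>A basis, indexed by \<open>J\<close> and consisting of homogeneous elements in order of increasing degree,
  of the space spanned by the strata \<open>S k\<close> with \<open>k \<in> K\<close>.\<close>

definition adapted_basis ::
    "int set \<Rightarrow> (int \<Rightarrow> 'v::real_vector set) \<Rightarrow> int set \<Rightarrow> (int \<Rightarrow> 'v) \<Rightarrow> bool"
  where "adapted_basis K S J B \<longleftrightarrow>
     inj_on B J \<and> independent (B ` J) \<and> span (B ` J) = span (\<Union>k\<in>K. S k) \<and>
     (\<exists>d. (\<forall>j\<in>J. d j \<in> K \<and> B j \<in> S (d j)) \<and> (\<forall>i\<in>J. \<forall>j\<in>J. i < j \<longrightarrow> d i \<le> d j))"

text \<open>The \<open>l\<close>-th coordinate of \<open>x \<in> \<real>\<^sup>n\<close>, \<open>1 \<le> l \<le> n\<close>, is \<open>x $ idx l\<close>, where \<open>idx\<close> is an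
  enumeration of the index type. Points are their own exponential coordinates of the second type:
  \<open>x = exp (x\<^sub>n X\<^sub>n) \<cdot> \<dots> \<cdot> exp (x\<^sub>1 X\<^sub>1)\<close>.\<close>

definition exp_coordinates_second_type ::
    "(real^'n) monoid \<Rightarrow> (int \<Rightarrow> 'n::finite) \<Rightarrow> (int \<Rightarrow> real^'n \<Rightarrow> real^'n) \<Rightarrow> bool"
  where "exp_coordinates_second_type G idx X \<longleftrightarrow>
     (\<forall>x. foldl (\<lambda>p l. p \<otimes>\<^bsub>G\<^esub> lie_exp G ((x $ idx l) *\<^sub>R X l)) \<one>\<^bsub>G\<^esub> (rev [1..int CARD('n)]) = x)"


section \<open>Tanaka prolongation\<close>

text \<open>\<open>L\<close> is the carrier of a Lie algebra with bracket \<open>br\<close>. An element \<open>u\<close> of the prolongation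
  is a sum of an element of \<open>L\<close> and of a linear map from \<open>L\<close> to the prolongation whose
  homogeneous components have degree at most \<open>0\<close>. As such maps take values of higher degree, \<open>u\<close> is
  determined by the \<open>L\<close>-components of all its iterated brackets, and it is represented by
  the function taking \<open>[Z\<^sub>1, \<dots>, Z\<^sub>m]\<close> to the \<open>L\<close>-component of \<open>[\<dots>[[u, Z\<^sub>1], Z\<^sub>2], \<dots>, Z\<^sub>m]\<close>
  (to \<open>0\<close> if some \<open>Z\<^sub>i\<close> is not in \<open>L\<close>). So \<open>u []\<close> is the \<open>L\<close>-component of \<open>u\<close>, and a linear map \<open>\<phi>\<close>
  is represented in curried form: \<open>\<phi> [] = 0\<close>, and \<open>\<phi> (Z # zs) = \<phi>(Z) zs\<close>.\<close>

type_synonym 'v prol = "'v list \<Rightarrow> 'v"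

definition prol_emb :: "'v::real_vector set \<Rightarrow> ('v \<Rightarrow> 'v \<Rightarrow> 'v) \<Rightarrow> 'v \<Rightarrow> 'v prol"
  where "prol_emb L br X = (\<lambda>zs. if set zs \<subseteq> L then foldl br X zs else 0)"

definition prol_app :: "'v prol \<Rightarrow> 'v \<Rightarrow> 'v prol"
  where "prol_app u Z = (\<lambda>zs. u (Z # zs))"

text \<open>In the derivation rule for \<open>\<phi> \<in> \<gg>\<^sub>k\<close>, \<open>k \<le> 0\<close>, the bracket \<open>[X, \<phi>(Y)]\<close> is \<open>- [\<phi>(Y), X]\<close>.\<close>

function prol_stratum ::
    "'v::real_vector set \<Rightarrow> ('v \<Rightarrow> 'v \<Rightarrow> 'v) \<Rightarrow> (int \<Rightarrow> 'v set) \<Rightarrow> int \<Rightarrow> int \<Rightarrow> 'v prol set"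
  where "prol_stratum L br S s k =
    (if k \<ge> 1 then prol_emb L br ` S k
     else {\<phi>. \<phi> [] = 0 \<and> (\<forall>Z. Z \<notin> L \<longrightarrow> prol_app \<phi> Z = 0) \<and>
        (\<forall>X\<in>L. \<forall>Y\<in>L. \<forall>a b.
           prol_app \<phi> (a *\<^sub>R X + b *\<^sub>R Y) = a *\<^sub>R prol_app \<phi> X + b *\<^sub>R prol_app \<phi> Y) \<and>
        (\<forall>i\<in>{1..s}. \<forall>X\<in>S i. prol_app \<phi> X \<in> prol_stratum L br S s (k + i)) \<and>
        (\<forall>X\<in>L. \<forall>Y\<in>L.
           prol_app \<phi> (br X Y) = prol_app (prol_app \<phi> X) Y - prol_app (prol_app \<phi> Y) X)})"
  by auto
termination
  by (relation "Wellfounded.measure (\<lambda>(L, br, S, s, k). nat (1 - k))") auto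

declare prol_stratum.simps [simp del]

definition prol_nonpos :: "'v::real_vector set \<Rightarrow> ('v \<Rightarrow> 'v \<Rightarrow> 'v) \<Rightarrow> 'v prol \<Rightarrow> 'v prol"
  where "prol_nonpos L br u = u - prol_emb L br (u [])"

text \<open>With \<open>u = X + \<phi>\<close> and \<open>v = Y + \<psi>\<close>, where \<open>X, Y \<in> L\<close> and \<open>\<phi>, \<psi>\<close> have degree at most \<open>0\<close>:
  \<open>[u, v] = [X, Y] + \<phi>(Y) - \<psi>(X) + [\<phi>, \<psi>]\<close>, where \<open>[\<phi>, \<psi>](Z) = [\<phi>(Z), \<psi>] + [\<phi>, \<psi>(Z)]\<close>.\<close>

fun prol_bracket ::
    "'v::real_vector set \<Rightarrow> ('v \<Rightarrow> 'v \<Rightarrow> 'v) \<Rightarrow> 'v prol \<Rightarrow> 'v prol \<Rightarrow> 'v prol"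
  where "prol_bracket L br u v zs =
    (prol_emb L br (br (u []) (v [])) + prol_app (prol_nonpos L br u) (v [])
       - prol_app (prol_nonpos L br v) (u [])) zs
    + (case zs of [] \<Rightarrow> 0
       | Z # zs' \<Rightarrow>
           prol_bracket L br (prol_app (prol_nonpos L br u) Z) (prol_nonpos L br v) zs'
           + prol_bracket L br (prol_nonpos L br u) (prol_app (prol_nonpos L br v) Z) zs')"

declare prol_bracket.simps [simp del]


section \<open>Structure constants and extremal polynomials\<close>

text \<open>Coordinates with respect to the basis \<open>(B j)\<^sub>j\<close>, \<open>j \<in> J\<close>, extended by \<open>0\<close> to all indices.
  \<^const>\<open>Sum_any\<close> is the sum over the (finite) support of the summand.\<close>

definition coord :: "(int \<Rightarrow> 'v::real_vector) \<Rightarrow> int set \<Rightarrow> 'v \<Rightarrow> int \<Rightarrow> real"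
  where "coord B J u k = (if k \<in> J then representation (B ` J) u (B k) else 0)"

definition struct_const ::
    "'v::real_vector set \<Rightarrow> ('v \<Rightarrow> 'v \<Rightarrow> 'v) \<Rightarrow> (int \<Rightarrow> 'v prol) \<Rightarrow> int set \<Rightarrow> int \<Rightarrow> int \<Rightarrow> int \<Rightarrow> real"
  where "struct_const L br B J i j k = coord B J (prol_bracket L br (B i) (B j)) k"

text \<open>A multi-index assigns to each coordinate direction its exponent.\<close>

definition iter_bracket ::
    "'v::real_vector set \<Rightarrow> ('v \<Rightarrow> 'v \<Rightarrow> 'v) \<Rightarrow> (int \<Rightarrow> 'n::finite) \<Rightarrow> (int \<Rightarrow> 'v prol) \<Rightarrow>
     int \<Rightarrow> ('n \<Rightarrow> nat) \<Rightarrow> 'v prol"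
  where "iter_bracket L br idx B i \<alpha> =
     foldl (\<lambda>u l. ((\<lambda>w. prol_bracket L br w (B l)) ^^ \<alpha> (idx l)) u) (B i) [1..int CARD('n)]"

definition gen_struct_const ::
    "'v::real_vector set \<Rightarrow> ('v \<Rightarrow> 'v \<Rightarrow> 'v) \<Rightarrow> (int \<Rightarrow> 'n::finite) \<Rightarrow> (int \<Rightarrow> 'v prol) \<Rightarrow> int set \<Rightarrow>
     int \<Rightarrow> ('n \<Rightarrow> nat) \<Rightarrow> int \<Rightarrow> real"
  where "gen_struct_const L br idx B J i \<alpha> k = coord B J (iter_bracket L br idx B i \<alpha>) k"

definition ext_vec :: "(int \<Rightarrow> 'n::finite) \<Rightarrow> real^'n \<Rightarrow> int \<Rightarrow> real"
  where "ext_vec idx v k = (if 1 \<le> k \<and> k \<le> int CARD('n) then v $ idx k else 0)"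

definition extremal_poly ::
    "'v::real_vector set \<Rightarrow> ('v \<Rightarrow> 'v \<Rightarrow> 'v) \<Rightarrow> (int \<Rightarrow> 'n::finite) \<Rightarrow> (int \<Rightarrow> 'v prol) \<Rightarrow> int set \<Rightarrow>
     real^'n \<Rightarrow> int \<Rightarrow> real^'n \<Rightarrow> real"
  where "extremal_poly L br idx B J v i x =
     Sum_any (\<lambda>\<alpha>. (- 1) ^ (\<Sum>l\<in>UNIV. \<alpha> l) / (\<Prod>l\<in>UNIV. fact (\<alpha> l))
       * Sum_any (\<lambda>k. gen_struct_const L br idx B J i \<alpha> k * ext_vec idx v k)
       * (\<Prod>l\<in>UNIV. (x $ l) ^ \<alpha> l))"

end

theory Submission
  imports Defs
begin

text \<open>Let \<open>\<lambda>\<close> be the linear form \<open>u \<mapsto> \<Sum>\<^sub>k u\<^sub>k v\<^sub>k\<close> on the prolongation. Summing the exponential series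
  gives \<open>P\<^sub>u(x) = \<lambda>(exp (x\<^sub>n ad X\<^sub>n) \<dots> exp (x\<^sub>1 ad X\<^sub>1) u)\<close>, that is \<open>\<lambda>(Ad(x) u)\<close>, for every \<open>u\<close> in the
  prolongation, and the formula to prove reads \<open>X P\<^sub>u = P\<^bsub>[X, u]\<^esub>\<close>. Differentiating in \<open>x\<^sub>l\<close> and moving
  \<open>ad X\<^sub>l\<close> to the right past the factors with smaller indices gives \<open>\<partial>\<^sub>l P\<^sub>u (x) = P\<^bsub>[\<omega>, u]\<^esub>(x)\<close> with
  \<open>\<omega> = exp (- x\<^sub>1 ad X\<^sub>1) \<dots> exp (- x\<^bsub>l-1\<^esub> ad X\<^bsub>l-1\<^esub>) X\<^sub>l\<close>. In the group, the same field \<open>\<omega>\<close> takes the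
  value \<open>\<partial>\<^sub>l\<close> at \<open>x\<close>, because the flow of \<open>X\<^sub>k\<close> is the right translation by \<open>exp (t X\<^sub>k)\<close>; the formula
  follows, as both sides are linear in \<open>X\<close>.

  The difference of two solutions of the uniqueness problem is again linear in \<open>u\<close>. By induction on
  decreasing degree its derivatives along the first stratum vanish, hence so do all its derivatives,
  as the first stratum generates the Lie algebra.\<close>

section \<open>Second derivatives and vector fields\<close>

text \<open>Two separate computations have to produce the same element. In the group the factors
  with indices \<open>l - 1, ..., 1\<close> stand to the right of the \<open>l\<close>-th one, so
  its velocity is carried through right translations. In the prolongation the operators with indices
  \<open>1, ..., l - 1\<close> act before the \<open>l\<close>-th one, so its bracket is carried
  inward past them. Both leave the same fold of \<open>exp_ad\<close> over
  \<open>rev [1..l-1]\<close>; here the order of the factors in the coordinates has to match the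
  order of the brackets in the generalized structure constants.

  No convergence enters. The prolongation may be infinite dimensional, but bracketing with the Lie
  algebra of \<open>G\<close> raises the degree, which is bounded by \<open>s\<close>; so every
  element is killed by long iterated brackets and all exponentials are finite sums, truncated at an
  order that depends on the element.

  Every bracket in the statement has a factor in the Lie algebra of \<open>G\<close>, and such a
  bracket is the evaluation \<open>prol_app\<close>. Arbitrary elements \<open>u\<close> replace
  basis elements because \<open>[X i, B j]\<close> is in general not a basis element.\<close>

abbreviation fd :: "('a::real_normed_vector \<Rightarrow> 'b::real_normed_vector) \<Rightarrow> 'a \<Rightarrow> 'a \<Rightarrow> 'b"
  where "fd f x \<equiv> frechet_derivative f (at x)"

lemma fd_eq: "(f has_derivative f') (at x) \<Longrightarrow> fd f x = f'"
  using frechet_derivative_at by metis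

lemma smooth_differentiable: "smooth f \<Longrightarrow> f differentiable at x"
  unfolding smooth_def by (metis C_k.simps(2))

lemma smooth_has_derivative: "smooth f \<Longrightarrow> (f has_derivative fd f x) (at x)"
  using smooth_differentiable frechet_derivative_works by blast

lemma smooth_fd: "smooth f \<Longrightarrow> smooth (\<lambda>x. fd f x h)"
  unfolding smooth_def by (metis C_k.simps(2))

lemma smooth_linear_fd: "smooth f \<Longrightarrow> linear (fd f x)"
  by (simp add: linear_frechet_derivative smooth_differentiable)

lemma smooth_continuous_on: "smooth f \<Longrightarrow> continuous_on UNIV f"
  unfolding smooth_def by (metis C_k.simps(1))

lemma fd_along_line:
  assumes "f differentiable at (p + t *\<^sub>R h)"
  shows "((\<lambda>t. f (p + t *\<^sub>R h)) has_vector_derivative fd f (p + t *\<^sub>R h) h) (at t)"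
proof -
  have "(f has_derivative fd f (p + t *\<^sub>R h)) (at (p + t *\<^sub>R h))"
    using assms frechet_derivative_works by blast
  moreover have "((\<lambda>t. p + t *\<^sub>R h) has_derivative (\<lambda>s. s *\<^sub>R h)) (at t)"
    by (auto intro!: derivative_eq_intros)
  ultimately have "((\<lambda>t. f (p + t *\<^sub>R h)) has_derivative (\<lambda>s. fd f (p + t *\<^sub>R h) (s *\<^sub>R h))) (at t)"
    by (metis has_derivative_compose)
  then show ?thesis
    unfolding has_vector_derivative_def
    by (simp add: linear_scale[OF linear_frechet_derivative[OF assms]])
qed

text \<open>Both mixed partial derivatives are limits of the second difference quotient.\<close>

lemma second_difference_mean_value:
  fixes f :: "'a::euclidean_space \<Rightarrow> real"
  assumes f: "smooth f" and r: "0 < r"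
  shows "\<exists>a b. 0 < a \<and> a < r \<and> 0 < b \<and> b < r \<and>
    f (x + r *\<^sub>R h + r *\<^sub>R k) - f (x + r *\<^sub>R h) - f (x + r *\<^sub>R k) + f x
      = r * r * fd (\<lambda>y. fd f y h) (x + a *\<^sub>R h + b *\<^sub>R k) k"
proof -
  \<comment> \<open>The mean value theorem is used twice: \<open>\<phi>\<close> is a first
    difference in direction \<open>k\<close> that varies along \<open>h\<close>, and its derivative
    is in turn an increment of \<open>\<psi>\<close> along \<open>k\<close>.\<close>
  define \<phi> where "\<phi> a = f (x + r *\<^sub>R k + a *\<^sub>R h) - f (x + a *\<^sub>R h)" for a
  have d\<phi>: "(\<phi> has_real_derivative fd f (x + r *\<^sub>R k + a *\<^sub>R h) h - fd f (x + a *\<^sub>R h) h) (at a)" for a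
    unfolding \<phi>_def has_real_derivative_iff_has_vector_derivative
    by (intro has_vector_derivative_diff fd_along_line smooth_differentiable f)
  obtain a where a: "0 < a" "a < r"
    "\<phi> r - \<phi> 0 = (r - 0) * (fd f (x + r *\<^sub>R k + a *\<^sub>R h) h - fd f (x + a *\<^sub>R h) h)"
    using MVT2[of 0 r \<phi>, OF r d\<phi>] by blast
  define \<psi> where "\<psi> b = fd f (x + a *\<^sub>R h + b *\<^sub>R k) h" for b
  have d\<psi>: "(\<psi> has_real_derivative fd (\<lambda>y. fd f y h) (x + a *\<^sub>R h + b *\<^sub>R k) k) (at b)" for b
    unfolding \<psi>_def has_real_derivative_iff_has_vector_derivative
    by (intro fd_along_line[where f="\<lambda>y. fd f y h"] smooth_differentiable smooth_fd f)
  obtain b where b: "0 < b" "b < r"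
    "\<psi> r - \<psi> 0 = (r - 0) * fd (\<lambda>y. fd f y h) (x + a *\<^sub>R h + b *\<^sub>R k) k"
    using MVT2[of 0 r \<psi>, OF r d\<psi>] by blast
  have "f (x + r *\<^sub>R h + r *\<^sub>R k) - f (x + r *\<^sub>R h) - f (x + r *\<^sub>R k) + f x = \<phi> r - \<phi> 0"
    by (simp add: \<phi>_def algebra_simps)
  also have "\<dots> = r * (\<psi> r - \<psi> 0)"
    using a(3) by (simp add: \<psi>_def algebra_simps)
  also have "\<dots> = r * r * fd (\<lambda>y. fd f y h) (x + a *\<^sub>R h + b *\<^sub>R k) k"
    using b(3) by simp
  finally show ?thesis using a b by blast
qed

lemma second_difference_tendsto:
  fixes f :: "'a::euclidean_space \<Rightarrow> real"
  assumes f: "smooth f"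
  shows "((\<lambda>r. (f (x + r *\<^sub>R h + r *\<^sub>R k) - f (x + r *\<^sub>R h) - f (x + r *\<^sub>R k) + f x) / (r * r))
    \<longlongrightarrow> fd (\<lambda>y. fd f y h) x k) (at_right 0)"
proof -
  let ?F = "\<lambda>y. fd (\<lambda>y. fd f y h) y k"
  let ?q = "\<lambda>r. (f (x + r *\<^sub>R h + r *\<^sub>R k) - f (x + r *\<^sub>R h) - f (x + r *\<^sub>R k) + f x) / (r * r)"
  obtain a b where ab: "\<And>r. 0 < r \<Longrightarrow> 0 < a r \<and> a r < r \<and> 0 < b r \<and> b r < r \<and>
      f (x + r *\<^sub>R h + r *\<^sub>R k) - f (x + r *\<^sub>R h) - f (x + r *\<^sub>R k) + f x
        = r * r * ?F (x + a r *\<^sub>R h + b r *\<^sub>R k)"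
    using second_difference_mean_value[OF f, of _ x h k] by metis
  have a0: "(a \<longlongrightarrow> 0) (at_right 0)" and b0: "(b \<longlongrightarrow> 0) (at_right 0)"
    by (rule tendsto_sandwich[of "\<lambda>_. 0" _ _ "\<lambda>r. r"];
        use ab in \<open>auto simp: eventually_at_right_field intro!: exI[of _ 1] less_imp_le tendsto_eq_intros\<close>)+
  have "((\<lambda>r. x + a r *\<^sub>R h + b r *\<^sub>R k) \<longlongrightarrow> x + 0 *\<^sub>R h + 0 *\<^sub>R k) (at_right 0)"
    by (intro tendsto_intros a0 b0)
  moreover have "isCont ?F x"
    using smooth_continuous_on[OF smooth_fd[OF smooth_fd[OF f]]]
    by (simp add: continuous_on_eq_continuous_at)
  ultimately have "((\<lambda>r. ?F (x + a r *\<^sub>R h + b r *\<^sub>R k)) \<longlongrightarrow> ?F x) (at_right 0)"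
    using isCont_tendsto_compose[of x ?F] by simp
  moreover have "\<forall>\<^sub>F r in at_right 0. ?F (x + a r *\<^sub>R h + b r *\<^sub>R k) = ?q r"
    using ab by (auto simp: eventually_at_right_field intro!: exI[of _ 1])
  ultimately show ?thesis
    by (rule Lim_transform_eventually)
qed

lemma fd_commute_real:
  fixes f :: "'a::euclidean_space \<Rightarrow> real"
  assumes f: "smooth f"
  shows "fd (\<lambda>y. fd f y h) x k = fd (\<lambda>y. fd f y k) x h"
proof -
  have eq: "f (x + r *\<^sub>R h + r *\<^sub>R k) - f (x + r *\<^sub>R h) - f (x + r *\<^sub>R k) + f x =
    f (x + r *\<^sub>R k + r *\<^sub>R h) - f (x + r *\<^sub>R k) - f (x + r *\<^sub>R h) + f x" for r :: real
    by (simp add: algebra_simps)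
  show ?thesis
    using second_difference_tendsto[OF f, of x h k] second_difference_tendsto[OF f, of x k h]
    by (intro tendsto_unique[of "at_right 0"]) (simp_all add: eq)
qed

lemma fd_inner:
  assumes "f differentiable at x"
  shows "fd (\<lambda>y. f y \<bullet> b) x h = fd f x h \<bullet> b"
proof -
  have "(f has_derivative fd f x) (at x)"
    using assms frechet_derivative_works by blast
  then have "((\<lambda>y. f y \<bullet> b) has_derivative (\<lambda>h. fd f x h \<bullet> b)) (at x)"
    by (rule has_derivative_inner_left)
  then show ?thesis by (simp add: fd_eq)
qed

lemma C_k_inner: "C_k k f \<Longrightarrow> C_k k (\<lambda>y. f y \<bullet> b)"
proof (induction k arbitrary: f)
  case 0
  then show ?case by (auto intro: continuous_intros)
next
  case (Suc k)
  then have d: "f differentiable at x" for x by simp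
  have "(\<lambda>y. f y \<bullet> b) differentiable at x" for x
    using d[of x] unfolding differentiable_def
    by (metis has_derivative_inner_left)
  then show ?case using Suc by (simp add: fd_inner[OF d])
qed

text \<open>The mean value argument needs real values, so the vector-valued case is read off
  component by component.\<close>

lemma fd_commute:
  fixes f :: "'a::euclidean_space \<Rightarrow> 'b::euclidean_space"
  assumes f: "smooth f"
  shows "fd (\<lambda>y. fd f y h) x k = fd (\<lambda>y. fd f y k) x h"
proof (rule euclidean_eqI)
  fix b :: 'b
  have fb: "smooth (\<lambda>y. f y \<bullet> b)"
    using f C_k_inner unfolding smooth_def by blast
  have "fd (\<lambda>y. fd f y h) x k \<bullet> b = fd (\<lambda>y. fd (\<lambda>y. f y \<bullet> b) y h) x k" for h k
    by (simp add: fd_inner smooth_differentiable f smooth_fd)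
  then show "fd (\<lambda>y. fd f y h) x k \<bullet> b = fd (\<lambda>y. fd f y k) x h \<bullet> b"
    using fd_commute_real[OF fb] by metis
qed

lemma linear_fd_fd:
  assumes f: "smooth f"
  shows "linear (\<lambda>h. fd (\<lambda>y. fd f y h) x k)"
proof (rule linearI)
  fix h h' :: 'a and c :: real
  note d = smooth_has_derivative[OF smooth_fd[OF f]]
  have "((\<lambda>y. fd f y (h + h')) has_derivative
      (\<lambda>k. fd (\<lambda>y. fd f y h) x k + fd (\<lambda>y. fd f y h') x k)) (at x)"
    using has_derivative_add[OF d[of h] d[of h']] by (simp add: linear_add[OF smooth_linear_fd[OF f]])
  then show "fd (\<lambda>y. fd f y (h + h')) x k = fd (\<lambda>y. fd f y h) x k + fd (\<lambda>y. fd f y h') x k"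
    by (simp add: fd_eq)
  have "((\<lambda>y. fd f y (c *\<^sub>R h)) has_derivative (\<lambda>k. c *\<^sub>R fd (\<lambda>y. fd f y h) x k)) (at x)"
    using has_derivative_scaleR_right[OF d[of h]] by (simp add: linear_scale[OF smooth_linear_fd[OF f]])
  then show "fd (\<lambda>y. fd f y (c *\<^sub>R h)) x k = c *\<^sub>R fd (\<lambda>y. fd f y h) x k"
    by (simp add: fd_eq)
qed

text \<open>\<open>smooth\<close> speaks of differentials along fixed directions. Here the direction
  \<open>H s\<close> moves together with the point, so it is expanded in \<open>Basis\<close>; the
  product rule gives one term for the moving point and one for the moving direction.\<close>

lemma has_derivative_fd_apply:
  fixes f :: "'a::euclidean_space \<Rightarrow> 'b::euclidean_space"
    and q H :: "'c::real_normed_vector \<Rightarrow> 'a"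
  assumes f: "smooth f" and q: "(q has_derivative q') (at s)" and H: "(H has_derivative H') (at s)"
  shows "((\<lambda>s. fd f (q s) (H s)) has_derivative
    (\<lambda>d. fd (\<lambda>y. fd f y (H s)) (q s) (q' d) + fd f (q s) (H' d))) (at s)"
proof -
  have expand: "fd f y h = (\<Sum>b\<in>Basis. (h \<bullet> b) *\<^sub>R fd f y b)" for y h
    using linear_sum[OF smooth_linear_fd[OF f, of y], where g="\<lambda>b. (h \<bullet> b) *\<^sub>R b" and S=Basis]
    by (simp add: linear_scale[OF smooth_linear_fd[OF f]] euclidean_representation)
  have expand2: "fd (\<lambda>y. fd f y h) y k = (\<Sum>b\<in>Basis. (h \<bullet> b) *\<^sub>R fd (\<lambda>y. fd f y b) y k)" for y h k
    using linear_sum[OF linear_fd_fd[OF f, of y k], where g="\<lambda>b. (h \<bullet> b) *\<^sub>R b" and S=Basis]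
    by (simp add: linear_scale[OF linear_fd_fd[OF f]] euclidean_representation)
  have "((\<lambda>s. fd f (q s) b) has_derivative (\<lambda>d. fd (\<lambda>y. fd f y b) (q s) (q' d))) (at s)" for b
    using has_derivative_compose[OF q smooth_has_derivative[OF smooth_fd[OF f]]] .
  then have "((\<lambda>s. \<Sum>b\<in>Basis. (H s \<bullet> b) *\<^sub>R fd f (q s) b) has_derivative
    (\<lambda>d. \<Sum>b\<in>Basis. (H s \<bullet> b) *\<^sub>R fd (\<lambda>y. fd f y b) (q s) (q' d) + (H' d \<bullet> b) *\<^sub>R fd f (q s) b)) (at s)"
    by (intro has_derivative_sum has_derivative_scaleR has_derivative_inner_left H)
  moreover have "(\<lambda>s. \<Sum>b\<in>Basis. (H s \<bullet> b) *\<^sub>R fd f (q s) b) = (\<lambda>s. fd f (q s) (H s))"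
    by (rule ext) (rule expand[symmetric])
  moreover have "(\<Sum>b\<in>Basis. (H s \<bullet> b) *\<^sub>R fd (\<lambda>y. fd f y b) (q s) (q' d) + (H' d \<bullet> b) *\<^sub>R fd f (q s) b)
      = fd (\<lambda>y. fd f y (H s)) (q s) (q' d) + fd f (q s) (H' d)" for d
    by (simp only: sum.distrib expand[of "q s" "H' d"] expand2[of "H s" "q s" "q' d"])
  ultimately show ?thesis by simp
qed

lemma fd_fd_apply:
  fixes f :: "'a::euclidean_space \<Rightarrow> 'b::euclidean_space"
  assumes "smooth f" and "Y differentiable at x"
  shows "fd (\<lambda>y. fd f y (Y y)) x k = fd (\<lambda>y. fd f y (Y x)) x k + fd f x (fd Y x k)"
    and "(\<lambda>y. fd f y (Y y)) differentiable at x"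
proof -
  have "(Y has_derivative fd Y x) (at x)"
    using assms(2) frechet_derivative_works by blast
  from has_derivative_fd_apply[OF assms(1) has_derivative_ident this]
  show "fd (\<lambda>y. fd f y (Y y)) x k = fd (\<lambda>y. fd f y (Y x)) x k + fd f x (fd Y x k)"
    and "(\<lambda>y. fd f y (Y y)) differentiable at x"
    by (simp_all add: fd_eq) (auto simp: differentiable_def)
qed

lemma fd_diff:
  assumes "f differentiable at x" "g differentiable at x"
  shows "fd (\<lambda>y. f y - g y) x h = fd f x h - fd g x h"
proof -
  have "((\<lambda>y. f y - g y) has_derivative (\<lambda>h. fd f x h - fd g x h)) (at x)"
    using assms frechet_derivative_works by (intro has_derivative_diff) blast+
  then show ?thesis by (simp add: fd_eq)
qed

section \<open>Commutators of vector fields\<close>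

lemma fd_vf_bracket:
  assumes "smooth X" "smooth Y"
  shows "fd (vf_bracket X Y) x h =
    fd (\<lambda>y. fd Y y (X x)) x h + fd Y x (fd X x h) - fd (\<lambda>y. fd X y (Y x)) x h - fd X x (fd Y x h)"
proof -
  have "vf_bracket X Y = (\<lambda>y. fd Y y (X y) - fd X y (Y y))"
    by (rule ext) (simp add: vf_bracket_def)
  then show ?thesis
    using fd_fd_apply[OF assms(2) smooth_differentiable[OF assms(1)], of x]
      fd_fd_apply[OF assms(1) smooth_differentiable[OF assms(2)], of x]
    by (simp add: fd_diff)
qed

text \<open>Products of first derivatives cancel outright, second derivatives because mixed partials
  commute (\<open>sym\<close>). The identity is put in the shape of the derivation rule in
  \<open>prol_stratum\<close>, where all brackets are taken on the right.\<close>

lemma vf_bracket_jacobi: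
  assumes W: "smooth W" and Y: "smooth Y" and Z: "smooth Z"
  shows "vf_bracket W (vf_bracket Y Z) = vf_bracket (vf_bracket W Y) Z - vf_bracket (vf_bracket W Z) Y"
proof (rule ext)
  fix x
  note lin = linear_diff[OF smooth_linear_fd]
  have sym: "fd (\<lambda>y. fd W y (Z x)) x (Y x) = fd (\<lambda>y. fd W y (Y x)) x (Z x)"
    "fd (\<lambda>y. fd Y y (W x)) x (Z x) = fd (\<lambda>y. fd Y y (Z x)) x (W x)"
    "fd (\<lambda>y. fd Z y (W x)) x (Y x) = fd (\<lambda>y. fd Z y (Y x)) x (W x)"
    using assms by (auto intro: fd_commute)
  have "vf_bracket W (vf_bracket Y Z) x = fd (vf_bracket Y Z) x (W x) - fd W x (vf_bracket Y Z x)"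
    and "vf_bracket (vf_bracket W Y) Z x = fd Z x (vf_bracket W Y x) - fd (vf_bracket W Y) x (Z x)"
    and "vf_bracket (vf_bracket W Z) Y x = fd Y x (vf_bracket W Z x) - fd (vf_bracket W Z) x (Y x)"
    by (simp_all only: vf_bracket_def)
  then show "vf_bracket W (vf_bracket Y Z) x = (vf_bracket (vf_bracket W Y) Z - vf_bracket (vf_bracket W Z) Y) x"
    by (simp add: fd_vf_bracket assms vf_bracket_def lin sym)
qed

lemma vf_apply_bracket:
  assumes X: "smooth X" and Y: "smooth Y" and f: "smooth f"
  shows "vf_apply (vf_bracket X Y) f x = vf_apply X (vf_apply Y f) x - vf_apply Y (vf_apply X f) x"
proof -
  have "vf_apply X f = (\<lambda>y. fd f y (X y))" for X
    by (rule ext) (simp add: vf_apply_def)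
  then show ?thesis
    using fd_commute[OF f, of "Y x" x "X x"]
    using fd_fd_apply(1)[OF f smooth_differentiable[OF Y], of x "X x"]
      fd_fd_apply(1)[OF f smooth_differentiable[OF X], of x "Y x"]
    by (simp add: vf_apply_def vf_bracket_def linear_diff[OF smooth_linear_fd[OF f]])
qed

section \<open>Smoothness of polynomial functions\<close>

lemma real_polynomial_function_fd:
  assumes "real_polynomial_function f"
  shows "real_polynomial_function (\<lambda>x. fd f x h)"
  using assms
proof induction
  case (linear f)
  then show ?case
    by (simp add: fd_eq[OF bounded_linear_imp_has_derivative] real_polynomial_function.intros(2))
next
  case (const c)
  then show ?case by (simp add: real_polynomial_function.intros(2))
next
  case (add f g)
  then have "fd (\<lambda>x. f x + g x) x = (\<lambda>h. fd f x h + fd g x h)" for x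
    by (intro fd_eq has_derivative_add)
      (auto simp: frechet_derivative_works[symmetric] differentiable_at_real_polynomial_function)
  then show ?case using add by (auto intro: real_polynomial_function.intros)
next
  case (mult f g)
  then have "fd (\<lambda>x. f x * g x) x = (\<lambda>h. f x * fd g x h + fd f x h * g x)" for x
    by (intro fd_eq has_derivative_mult)
      (auto simp: frechet_derivative_works[symmetric] differentiable_at_real_polynomial_function)
  then show ?case using mult by (auto intro!: real_polynomial_function.intros(3,4))
qed

lemma smooth_real_polynomial_function:
  fixes f :: "'a::euclidean_space \<Rightarrow> real"
  assumes "real_polynomial_function f"
  shows "smooth f"
proof -
  have "C_k k f" for k
    using assms
  proof (induction k arbitrary: f)
    case 0
    then show ?case
      by (simp add: continuous_on_polymonial_function real_polynomial_function_eq)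
  next
    case (Suc k)
    then show ?case
      by (simp add: differentiable_at_real_polynomial_function real_polynomial_function_fd)
  qed
  then show ?thesis by (simp add: smooth_def)
qed

lemma vf_bracket_add_left:
  assumes "smooth X" "smooth Y" "smooth Z"
  shows "vf_bracket (X + Y) Z = vf_bracket X Z + vf_bracket Y Z"
proof (rule ext)
  fix x
  have "((\<lambda>y. X y + Y y) has_derivative (\<lambda>h. fd X x h + fd Y x h)) (at x)"
    by (intro has_derivative_add smooth_has_derivative assms)
  then have "fd (X + Y) x = (\<lambda>h. fd X x h + fd Y x h)"
    by (simp add: fd_eq plus_fun_def)
  then show "vf_bracket (X + Y) Z x = (vf_bracket X Z + vf_bracket Y Z) x"
    by (simp add: vf_bracket_def linear_add[OF smooth_linear_fd[OF assms(3)]])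
qed

lemma vf_bracket_scale_left:
  assumes "smooth X" "smooth Z"
  shows "vf_bracket (c *\<^sub>R X) Z = c *\<^sub>R vf_bracket X Z"
proof (rule ext)
  fix x
  have "((\<lambda>y. c *\<^sub>R X y) has_derivative (\<lambda>h. c *\<^sub>R fd X x h)) (at x)"
    by (intro has_derivative_scaleR_right smooth_has_derivative assms)
  then have "fd (c *\<^sub>R X) x = (\<lambda>h. c *\<^sub>R fd X x h)"
    by (simp add: fd_eq scaleR_fun_def)
  then show "vf_bracket (c *\<^sub>R X) Z x = (c *\<^sub>R vf_bracket X Z) x"
    by (simp add: vf_bracket_def scaleR_fun_def linear_scale[OF smooth_linear_fd[OF assms(2)]] scaleR_diff_right)
qed

lemma vf_bracket_antisym: "vf_bracket X Y = - vf_bracket Y X"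
  by (rule ext) (simp add: vf_bracket_def)

section \<open>Left-invariant fields in exponential coordinates\<close>

text \<open>The series of \<open>exp (- t ad X)\<close>, truncated.\<close>

definition exp_ad :: "('v::real_vector \<Rightarrow> 'v \<Rightarrow> 'v) \<Rightarrow> nat \<Rightarrow> 'v \<Rightarrow> real \<Rightarrow> 'v \<Rightarrow> 'v"
  where "exp_ad br N X t Y = (\<Sum>k<N. ((- t) ^ k / fact k) *\<^sub>R (br X ^^ k) Y)"

text \<open>Each coefficient differentiates to minus the previous one. The case \<open>k = 0\<close>
  is separate because natural subtraction makes \<open>k - 1\<close> equal to \<open>0\<close>,
  which would give \<open>- 1\<close> instead of \<open>0\<close>.\<close>

lemma exp_coefficient_derivative:
  "((\<lambda>t. (- t) ^ k / fact k) has_real_derivative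
    - (if k = 0 then 0 else (- t) ^ (k - 1) / fact (k - 1))) (at t)"
proof (cases k)
  case (Suc m)
  have "((\<lambda>t. (- t) ^ Suc m / fact (Suc m)) has_real_derivative
      (real (Suc m) * (- t) ^ m * - 1) / fact (Suc m)) (at t)"
    by (rule derivative_eq_intros refl | simp)+
  also have "(real (Suc m) * (- t) ^ m * - 1) / fact (Suc m) = - ((- t) ^ m / fact m)"
    by (simp add: fact_Suc del: of_nat_Suc)
  finally show ?thesis using Suc by simp
qed simp

lemma sum_fun_apply: "sum f A x = (\<Sum>a\<in>A. f a x)"
  by (induction A rule: infinite_finite_induct) auto

section \<open>Integral curves, translations and the exponential map\<close>

definition integral_curve :: "('a::euclidean_space) monoid \<Rightarrow> ('a \<Rightarrow> 'a) \<Rightarrow> (real \<Rightarrow> 'a) \<Rightarrow> bool"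
  where "integral_curve G X \<gamma> \<longleftrightarrow> \<gamma> 0 = \<one>\<^bsub>G\<^esub> \<and> (\<forall>t. (\<gamma> has_vector_derivative X (\<gamma> t)) (at t))"

definition left_invariant :: "('a::euclidean_space) monoid \<Rightarrow> ('a \<Rightarrow> 'a) \<Rightarrow> bool"
  where "left_invariant G X \<longleftrightarrow> (\<forall>a x. X (a \<otimes>\<^bsub>G\<^esub> x) = fd (\<lambda>y. a \<otimes>\<^bsub>G\<^esub> y) x (X x))"

lemma lie_algebraD:
  assumes "X \<in> lie_algebra G"
  shows "smooth X" "left_invariant G X"
  using assms by (auto simp: lie_algebra_def left_invariant_def)

lemma lie_exp_eq: "lie_exp G X = (THE p. \<exists>\<gamma>. integral_curve G X \<gamma> \<and> p = \<gamma> 1)"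
  by (simp add: lie_exp_def integral_curve_def conj_assoc)

lemma integral_curve_scale:
  assumes "integral_curve G X \<gamma>"
  shows "integral_curve G (c *\<^sub>R X) (\<lambda>t. \<gamma> (c * t))"
proof -
  have "((\<lambda>t. \<gamma> (c * t)) has_vector_derivative c *\<^sub>R X (\<gamma> (c * t))) (at t)" for t
  proof -
    have "((\<lambda>t. c * t) has_vector_derivative c) (at t)"
      by (auto intro!: derivative_eq_intros)
    then show ?thesis
      using assms vector_diff_chain_at[of "\<lambda>t. c * t" c t \<gamma>]
      by (auto simp: integral_curve_def o_def)
  qed
  then show ?thesis using assms by (simp add: integral_curve_def scaleR_fun_def)
qed

locale euclidean_lie_group =
  fixes G :: "('a::euclidean_space) monoid" (structure)
  assumes lie_group: "lie_group G"
begin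

lemma carrier_UNIV [simp]: "carrier G = UNIV"
  using lie_group by (simp add: lie_group_def)

sublocale group G
  using lie_group by (simp add: lie_group_def)

abbreviation mul :: "'a \<times> 'a \<Rightarrow> 'a"
  where "mul p \<equiv> fst p \<otimes> snd p"

lemma smooth_mul: "smooth mul"
  using lie_group by (simp add: lie_group_def)

lemma linear_fd_mul: "linear (fd mul p)"
  using smooth_linear_fd smooth_mul by blast

lemma has_derivative_mul:
  assumes "(p has_derivative p') (at s)" "(q has_derivative q') (at s)"
  shows "((\<lambda>s. p s \<otimes> q s) has_derivative (\<lambda>d. fd mul (p s, q s) (p' d, q' d))) (at s)"
  using has_derivative_compose[OF has_derivative_Pair[OF assms] smooth_has_derivative[OF smooth_mul]]
  by simp

lemma has_derivative_mul_left: "((\<lambda>y. a \<otimes> y) has_derivative (\<lambda>h. fd mul (a, x) (0, h))) (at x)"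
  using has_derivative_mul[OF has_derivative_const has_derivative_ident] .

lemma has_derivative_mul_right: "((\<lambda>y. y \<otimes> b) has_derivative (\<lambda>h. fd mul (x, b) (h, 0))) (at x)"
  using has_derivative_mul[OF has_derivative_ident has_derivative_const] .

lemmas fd_mul_left = fd_eq[OF has_derivative_mul_left]
lemmas fd_mul_right = fd_eq[OF has_derivative_mul_right]

lemma linear_fd_mul_right: "linear (fd (\<lambda>y. y \<otimes> b) x)"
  using has_derivative_linear[OF has_derivative_mul_right] by (simp add: fd_mul_right)

lemma left_invariant_eq: "left_invariant G X \<Longrightarrow> X (a \<otimes> x) = fd mul (a, x) (0, X x)"
  by (simp add: left_invariant_def fd_mul_left)

lemma left_invariant_scale: "left_invariant G X \<Longrightarrow> left_invariant G (c *\<^sub>R X)"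
  using linear_scale[OF has_derivative_linear[OF has_derivative_mul_left]]
  by (simp add: left_invariant_def fd_mul_left scaleR_fun_def)

lemma left_invariant_translate:
  assumes "left_invariant G X" "(c has_vector_derivative X (c t)) (at t)"
  shows "((\<lambda>t. a \<otimes> c t) has_vector_derivative X (a \<otimes> c t)) (at t)"
proof -
  have "(c has_derivative (\<lambda>d. d *\<^sub>R X (c t))) (at t)"
    using assms by (simp add: has_vector_derivative_def)
  from has_derivative_compose[OF this has_derivative_mul_left]
  have "((\<lambda>t. a \<otimes> c t) has_derivative (\<lambda>d. fd mul (a, c t) (0, d *\<^sub>R X (c t)))) (at t)" .
  moreover have "fd mul (a, c t) (0, d *\<^sub>R X (c t)) = d *\<^sub>R X (a \<otimes> c t)" for d
    using linear_scale[OF linear_fd_mul, of "(a, c t)" d "(0, X (c t))"] left_invariant_eq[OF assms(1)]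
    by simp
  ultimately show ?thesis by (simp add: has_vector_derivative_def)
qed

lemma right_translate:
  assumes "(c has_vector_derivative v) (at t)"
  shows "((\<lambda>t. c t \<otimes> b) has_vector_derivative fd (\<lambda>y. y \<otimes> b) (c t) v) (at t)"
proof -
  have "(c has_derivative (\<lambda>d. d *\<^sub>R v)) (at t)"
    using assms by (simp add: has_vector_derivative_def)
  from has_derivative_compose[OF this has_derivative_mul_right, of b]
  have "((\<lambda>t. c t \<otimes> b) has_derivative (\<lambda>d. fd (\<lambda>y. y \<otimes> b) (c t) (d *\<^sub>R v))) (at t)"
    by (simp add: fd_mul_right)
  then show ?thesis
    by (simp add: has_vector_derivative_def linear_scale[OF linear_fd_mul_right])
qed

lemma fd_mul_right_comp:
  "fd (\<lambda>y. y \<otimes> (b \<otimes> c)) x h = fd (\<lambda>y. y \<otimes> c) (x \<otimes> b) (fd (\<lambda>y. y \<otimes> b) x h)"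
proof -
  have "((\<lambda>y. (y \<otimes> b) \<otimes> c) has_derivative
      (\<lambda>h. fd (\<lambda>y. y \<otimes> c) (x \<otimes> b) (fd (\<lambda>y. y \<otimes> b) x h))) (at x)"
    using has_derivative_compose[OF has_derivative_mul_right has_derivative_mul_right]
    by (simp add: fd_mul_right)
  then show ?thesis by (simp add: m_assoc fd_eq)
qed

lemma fd_mul_one: "fd (\<lambda>y. y \<otimes> \<one>) x h = h"
  by (simp add: fd_eq[OF has_derivative_ident])

text \<open>The quotient \<open>\<gamma> \<eta>\<^sup>-\<^sup>1\<close> of two integral curves is constant: up to left translation by its
  value at \<open>t\<close>, it agrees to first order at \<open>t\<close> with \<open>\<eta> \<eta>\<^sup>-\<^sup>1\<close>.\<close>

lemma integral_curve_unique:
  assumes X: "left_invariant G X" and \<gamma>: "integral_curve G X \<gamma>" and \<eta>: "integral_curve G X \<eta>"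
  shows "\<gamma> = \<eta>"
proof -
  have d\<gamma>: "(\<gamma> has_derivative (\<lambda>d. d *\<^sub>R X (\<gamma> t))) (at t)"
    and d\<eta>: "(\<eta> has_derivative (\<lambda>d. d *\<^sub>R X (\<eta> t))) (at t)" for t
    using \<gamma> \<eta> by (auto simp: integral_curve_def has_vector_derivative_def)
  have "smooth (\<lambda>x. inv x)"
    using lie_group by (simp add: lie_group_def)
  from has_derivative_compose[OF d\<eta> smooth_has_derivative[OF this]]
  have dinv: "((\<lambda>s. inv (\<eta> s)) has_derivative (\<lambda>d. fd (\<lambda>x. inv x) (\<eta> t) (d *\<^sub>R X (\<eta> t)))) (at t)" for t .
  have "((\<lambda>s. \<gamma> s \<otimes> inv (\<eta> s)) has_derivative (\<lambda>d. 0)) (at t)" for t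
  proof -
    define c where "c = \<gamma> t \<otimes> inv (\<eta> t)"
    have c: "c \<otimes> \<eta> t = \<gamma> t" by (simp add: c_def m_assoc)
    have "((\<lambda>s. c \<otimes> \<eta> s) has_vector_derivative X (c \<otimes> \<eta> t)) (at t)"
      using left_invariant_translate[OF X] d\<eta> by (simp add: has_vector_derivative_def)
    then have "((\<lambda>s. c \<otimes> \<eta> s) has_derivative (\<lambda>d. d *\<^sub>R X (\<gamma> t))) (at t)"
      by (simp add: has_vector_derivative_def c)
    from has_derivative_mul[OF this dinv]
    have "((\<lambda>s. c) has_derivative
      (\<lambda>d. fd mul (\<gamma> t, inv (\<eta> t)) (d *\<^sub>R X (\<gamma> t), fd (\<lambda>x. inv x) (\<eta> t) (d *\<^sub>R X (\<eta> t))))) (at t)"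
      by (simp add: m_assoc c)
    from has_derivative_unique[OF this has_derivative_const]
    show ?thesis using has_derivative_mul[OF d\<gamma> dinv, of t] by simp
  qed
  then obtain e where e: "\<gamma> s \<otimes> inv (\<eta> s) = e" for s
    using has_derivative_zero_constant[of UNIV "\<lambda>s. \<gamma> s \<otimes> inv (\<eta> s)"] by auto
  moreover have "e = \<one>"
    using e[of 0] \<gamma> \<eta> by (simp add: integral_curve_def)
  ultimately have "\<gamma> s = \<eta> s" for s
    by (metis UNIV_I carrier_UNIV inv_equality inv_inv)
  then show ?thesis ..
qed

lemma lie_exp_integral_curve:
  assumes "left_invariant G X" "integral_curve G X \<gamma>"
  shows "lie_exp G X = \<gamma> 1"
  unfolding lie_exp_eq using assms integral_curve_unique by (intro the_equality) blast+

lemma lie_exp_zero: "lie_exp G 0 = \<one>"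
proof (rule lie_exp_integral_curve[where \<gamma>="\<lambda>_. \<one>"])
  show "left_invariant G 0"
    using linear_0[OF has_derivative_linear[OF has_derivative_mul_left]]
    by (simp add: left_invariant_def fd_mul_left)
qed (simp add: integral_curve_def)

text \<open>Without an integral curve of \<open>X\<close>, the definite description of \<^const>\<open>lie_exp\<close> has the same
  junk value for all nonzero multiples of \<open>X\<close>.\<close>

lemma integral_curve_of_lie_exp:
  assumes X: "left_invariant G X" and \<gamma>: "\<And>t. lie_exp G (t *\<^sub>R X) = \<gamma> t" and "\<gamma> 1 \<noteq> \<gamma> 2"
  shows "integral_curve G X \<gamma>"
proof -
  have "\<exists>\<eta>. integral_curve G X \<eta>"
  proof (rule ccontr)
    assume no: "\<nexists>\<eta>. integral_curve G X \<eta>"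
    have "lie_exp G (t *\<^sub>R X) = (THE p. False)" if "t \<noteq> 0" for t
    proof -
      have "\<not> integral_curve G (t *\<^sub>R X) \<eta>" for \<eta>
        using no integral_curve_scale[of G "t *\<^sub>R X" \<eta> "1 / t"] that by auto
      then show ?thesis unfolding lie_exp_eq by simp
    qed
    from this[of 1] this[of 2] show False
      using \<gamma>[of 1] \<gamma>[of 2] \<open>\<gamma> 1 \<noteq> \<gamma> 2\<close> by simp
  qed
  then obtain \<eta> where \<eta>: "integral_curve G X \<eta>" ..
  have "\<gamma> t = \<eta> t" for t
    using lie_exp_integral_curve[OF left_invariant_scale[OF X] integral_curve_scale[OF \<eta>], of t] \<gamma>
    by simp
  then have "\<gamma> = \<eta>" ..
  with \<eta> show ?thesis by simp
qed

text \<open>Both \<open>\<gamma>\<close> and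
  \<open>\<lambda>t. inv (\<gamma> s) \<otimes> \<gamma> (s + t)\<close> are integral curves of
  \<open>X\<close> through the unit, so uniqueness makes \<open>\<gamma>\<close> a one-parameter
  subgroup.\<close>

lemma integral_curve_add:
  assumes X: "left_invariant G X" and \<gamma>: "integral_curve G X \<gamma>"
  shows "\<gamma> (s + t) = \<gamma> s \<otimes> \<gamma> t"
proof -
  have "((\<lambda>t. \<gamma> (s + t)) has_vector_derivative X (\<gamma> (s + t))) (at t)" for t
  proof -
    have "((\<lambda>t. s + t) has_vector_derivative 1) (at t)"
      by (auto intro!: derivative_eq_intros)
    then show ?thesis
      using \<gamma> vector_diff_chain_at[of "\<lambda>t. s + t" 1 t \<gamma>]
      by (auto simp: integral_curve_def o_def)
  qed
  then have "integral_curve G X (\<lambda>t. inv (\<gamma> s) \<otimes> \<gamma> (s + t))"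
    using left_invariant_translate[OF X, of "\<lambda>t. \<gamma> (s + t)"] by (simp add: integral_curve_def)
  then have "inv (\<gamma> s) \<otimes> \<gamma> (s + t) = \<gamma> t"
    by (rule fun_cong[OF integral_curve_unique[OF X _ \<gamma>]])
  then show ?thesis by (metis UNIV_I carrier_UNIV inv_solve_left)
qed

lemma integral_curve_minus:
  assumes "left_invariant G X" "integral_curve G X \<gamma>"
  shows "\<gamma> t \<otimes> \<gamma> (- t) = \<one>" "\<gamma> (- t) \<otimes> \<gamma> t = \<one>"
  using integral_curve_add[OF assms, of t "- t"] integral_curve_add[OF assms, of "- t" t] assms(2)
  by (simp_all add: integral_curve_def)

text \<open>The pullback of \<open>Y\<close> to \<open>p\<close> along the flow of \<open>X\<close>, which is the right translation by \<open>\<gamma>\<close>.\<close>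

definition flow_pullback :: "(real \<Rightarrow> 'a) \<Rightarrow> ('a \<Rightarrow> 'a) \<Rightarrow> 'a \<Rightarrow> real \<Rightarrow> 'a"
  where "flow_pullback \<gamma> Y p t = fd (\<lambda>y. y \<otimes> \<gamma> (- t)) (p \<otimes> \<gamma> t) (Y (p \<otimes> \<gamma> t))"

text \<open>Written with \<open>fd mul\<close>, the pullback depends on \<open>s\<close> through the
  field, the left factor \<open>p \<otimes> \<gamma> s\<close> and the right factor
  \<open>\<gamma> (- s)\<close>. The field contributes \<open>fd Y p (X p)\<close>. The left factor
  contributes nothing, as right translation by the unit is the identity (\<open>D1\<close>). The
  right factor contributes a mixed second derivative of \<open>mul\<close>; exchanging the order of
  differentiation makes it the derivative of
  \<open>\<lambda>q. fd mul (q, \<one>) (0, X \<one>)\<close>, which is \<open>X\<close> itself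
  (\<open>D2\<close>).\<close>

lemma lie_derivative_at_0:
  assumes X: "smooth X" "left_invariant G X" and \<gamma>: "integral_curve G X \<gamma>" and Y: "smooth Y"
  shows "(flow_pullback \<gamma> Y p has_vector_derivative vf_bracket X Y p) (at 0)"
proof -
  have \<gamma>0: "\<gamma> 0 = \<one>" using \<gamma> by (simp add: integral_curve_def)
  have dp: "((\<lambda>s. p \<otimes> \<gamma> s) has_derivative (\<lambda>d. d *\<^sub>R X p)) (at 0)"
    using left_invariant_translate[OF X(2), of \<gamma> 0 p] \<gamma>[unfolded integral_curve_def, THEN conjunct2, rule_format, of 0]
    by (simp add: has_vector_derivative_def \<gamma>0)
  have "((\<lambda>s. \<gamma> (- s)) has_vector_derivative - X \<one>) (at 0)"
    using integral_curve_scale[OF \<gamma>, of "-1"] \<gamma>0 by (simp add: integral_curve_def) (metis \<gamma>0 minus_zero scaleR_fun_def scaleR_minus1_left)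
  then have dm: "((\<lambda>s. \<gamma> (- s)) has_derivative (\<lambda>d. d *\<^sub>R - X \<one>)) (at 0)"
    by (simp add: has_vector_derivative_def)
  have dY: "((\<lambda>s. Y (p \<otimes> \<gamma> s)) has_derivative (\<lambda>d. fd Y p (d *\<^sub>R X p))) (at 0)"
    using has_derivative_compose[OF dp smooth_has_derivative[OF Y]] \<gamma>0 by simp
  have d: "((\<lambda>s. fd mul (p \<otimes> \<gamma> s, \<gamma> (- s)) (Y (p \<otimes> \<gamma> s), 0)) has_derivative
    (\<lambda>d. fd (\<lambda>q. fd mul q (Y p, 0)) (p, \<one>) (d *\<^sub>R X p, d *\<^sub>R - X \<one>)
      + fd mul (p, \<one>) (fd Y p (d *\<^sub>R X p), 0))) (at 0)"
    using has_derivative_fd_apply[OF smooth_mul has_derivative_Pair[OF dp dm]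
        has_derivative_Pair[OF dY has_derivative_const[of 0]]] \<gamma>0
    by simp
  have one: "fd mul (q, \<one>) (h, 0) = h" for q h
    by (metis fd_mul_right fd_mul_one)
  let ?D = "\<lambda>h. fd (\<lambda>q. fd mul q h) (p, \<one>)"
  have pr: "((\<lambda>q. (q, \<one>)) has_derivative (\<lambda>h. (h, 0))) (at p)"
    by (intro has_derivative_Pair has_derivative_ident has_derivative_const)
  have along: "((\<lambda>q. fd mul (q, \<one>) h) has_derivative (\<lambda>k. ?D h (k, 0))) (at p)" for h
    using has_derivative_compose[OF pr smooth_has_derivative[OF smooth_fd[OF smooth_mul]]] .
  have D1: "?D (Y p, 0) (X p, 0) = 0"
    by (rule fun_cong[OF has_derivative_unique[OF along[of "(Y p, 0)", unfolded one] has_derivative_const]])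
  have "fd mul (q, \<one>) (0, X \<one>) = X q" for q
    using left_invariant_eq[OF X(2), of q \<one>] by simp
  then have "?D (0, X \<one>) (Y p, 0) = fd X p (Y p)"
    using along[of "(0, X \<one>)"] by (simp add: fd_eq)
  then have D2: "?D (Y p, 0) (0, X \<one>) = fd X p (Y p)"
    using fd_commute[OF smooth_mul, of "(Y p, 0)" "(p, \<one>)" "(0, X \<one>)"] by simp
  have lin: "linear (?D (Y p, 0))"
    using smooth_linear_fd[OF smooth_fd[OF smooth_mul]] .
  have "?D (Y p, 0) (d *\<^sub>R X p, d *\<^sub>R - X \<one>) = d *\<^sub>R (?D (Y p, 0) (X p, 0) - ?D (Y p, 0) (0, X \<one>))" for d
    by (simp add: linear_diff[OF lin, symmetric] linear_scale[OF lin, symmetric])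
  then have D: "?D (Y p, 0) (d *\<^sub>R X p, d *\<^sub>R - X \<one>) + fd mul (p, \<one>) (fd Y p (d *\<^sub>R X p), 0)
      = d *\<^sub>R vf_bracket X Y p" for d
    by (simp add: D1 D2 one vf_bracket_def linear_scale[OF smooth_linear_fd[OF Y]] scaleR_diff_right)
  have "flow_pullback \<gamma> Y p = (\<lambda>s. fd mul (p \<otimes> \<gamma> s, \<gamma> (- s)) (Y (p \<otimes> \<gamma> s), 0))"
    by (rule ext) (simp add: flow_pullback_def fd_mul_right)
  then show ?thesis
    using d unfolding D by (simp add: has_vector_derivative_def)
qed

text \<open>The flow is a one-parameter group: the pullback near time \<open>t\<close> is the one
  near time \<open>0\<close> based at \<open>z \<otimes> \<gamma> t\<close>, followed by the fixed
  linear map \<open>?R\<close>.\<close>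

lemma lie_derivative:
  assumes X: "smooth X" "left_invariant G X" and \<gamma>: "integral_curve G X \<gamma>" and Y: "smooth Y"
  shows "(flow_pullback \<gamma> Y z has_vector_derivative flow_pullback \<gamma> (vf_bracket X Y) z t) (at t)"
proof -
  let ?R = "fd (\<lambda>y. y \<otimes> \<gamma> (- t)) (z \<otimes> \<gamma> t)"
  have eq: "flow_pullback \<gamma> Y z u = ?R (flow_pullback \<gamma> Y (z \<otimes> \<gamma> t) (u - t))" for u
  proof -
    have add: "\<gamma> u = \<gamma> t \<otimes> \<gamma> (u - t)" "\<gamma> (- u) = \<gamma> (- (u - t)) \<otimes> \<gamma> (- t)"
      using integral_curve_add[OF X(2) \<gamma>, of t "u - t"] integral_curve_add[OF X(2) \<gamma>, of "- (u - t)" "- t"]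
      by simp_all
    have "z \<otimes> \<gamma> u \<otimes> \<gamma> (- (u - t)) = z \<otimes> \<gamma> t"
      using integral_curve_minus[OF X(2) \<gamma>, of "u - t"] by (simp add: add m_assoc)
    then show ?thesis
      unfolding flow_pullback_def add(2) fd_mul_right_comp by (simp add: m_assoc flip: add(1))
  qed
  have "((\<lambda>u. u - t) has_vector_derivative 1) (at t)"
    by (auto intro!: derivative_eq_intros)
  then have "((\<lambda>u. flow_pullback \<gamma> Y (z \<otimes> \<gamma> t) (u - t)) has_vector_derivative
      vf_bracket X Y (z \<otimes> \<gamma> t)) (at t)"
    using vector_diff_chain_at[of "\<lambda>u. u - t" 1 t "flow_pullback \<gamma> Y (z \<otimes> \<gamma> t)"]
      lie_derivative_at_0[OF X \<gamma> Y] by (auto simp: o_def)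
  from bounded_linear.has_vector_derivative[OF linear_conv_bounded_linear[THEN iffD1, OF linear_fd_mul_right[of "\<gamma> (- t)" "z \<otimes> \<gamma> t"]] this]
  show ?thesis by (simp add: eq[symmetric] flow_pullback_def[of _ "vf_bracket X Y"])
qed

text \<open>\<open>\<phi> k\<close> is the \<open>k\<close>-th derivative of the pullback of
  \<open>Y\<close>, and \<open>\<Phi> t\<close> is the Taylor polynomial of that pullback about
  \<open>t\<close>, evaluated at \<open>0\<close>. The derivative of \<open>\<Phi>\<close>
  telescopes to a multiple of \<open>\<phi> N\<close>, which is zero by \<open>nil\<close>. Hence
  \<open>\<Phi> t = Y z\<close>, and undoing the right translation by \<open>\<gamma> (- t)\<close>
  gives the formula.\<close>

lemma fd_mul_right_exp_ad:
  assumes X: "smooth X" "left_invariant G X" and \<gamma>: "integral_curve G X \<gamma>"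
    and Y: "\<And>k. smooth ((vf_bracket X ^^ k) Y)" and nil: "(vf_bracket X ^^ N) Y = 0"
  shows "fd (\<lambda>y. y \<otimes> \<gamma> t) z (Y z) = exp_ad vf_bracket N X t Y (z \<otimes> \<gamma> t)"
proof -
  define \<phi> where "\<phi> k = flow_pullback \<gamma> ((vf_bracket X ^^ k) Y) z" for k
  define c where "c k t = (- t) ^ k / fact k" for k and t :: real
  have d\<phi>: "(\<phi> k has_vector_derivative \<phi> (Suc k) t) (at t)" for k t
    using lie_derivative[OF X \<gamma> Y] by (simp add: \<phi>_def)
  have dc: "(c k has_real_derivative - (if k = 0 then 0 else c (k - 1) t)) (at t)" for k t
    unfolding c_def[abs_def] by (rule exp_coefficient_derivative)
  define \<Phi> where "\<Phi> t = (\<Sum>k<N. c k t *\<^sub>R \<phi> k t)" for t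
  have "(\<Phi> has_vector_derivative 0) (at t)" for t
  proof -
    define a where "a k = (if k = 0 then 0 else c (k - 1) t *\<^sub>R \<phi> k t)" for k
    have "(\<Phi> has_vector_derivative
        (\<Sum>k<N. c k t *\<^sub>R \<phi> (Suc k) t + (- (if k = 0 then 0 else c (k - 1) t)) *\<^sub>R \<phi> k t)) (at t)"
      unfolding \<Phi>_def
      by (intro has_vector_derivative_sum has_vector_derivative_scaleR d\<phi> dc)
    also have "(\<Sum>k<N. c k t *\<^sub>R \<phi> (Suc k) t + (- (if k = 0 then 0 else c (k - 1) t)) *\<^sub>R \<phi> k t)
        = (\<Sum>k<N. a (Suc k) - a k)"
      by (intro sum.cong) (auto simp: a_def)
    also have "\<dots> = a N - a 0"
      by (rule sum_lessThan_telescope)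
    also have "\<dots> = 0"
      using linear_0[OF linear_fd_mul_right] by (simp add: a_def \<phi>_def nil flow_pullback_def)
    finally show ?thesis .
  qed
  then obtain e where e: "\<Phi> t = e" for t
    using has_derivative_zero_constant[of UNIV \<Phi>] by (auto simp: has_vector_derivative_def)
  have lin: "\<Phi> t = fd (\<lambda>y. y \<otimes> \<gamma> (- t)) (z \<otimes> \<gamma> t) (exp_ad vf_bracket N X t Y (z \<otimes> \<gamma> t))" for t
    by (simp add: \<Phi>_def exp_ad_def c_def \<phi>_def flow_pullback_def sum_fun_apply scaleR_fun_def
        linear_sum[OF linear_fd_mul_right] linear_scale[OF linear_fd_mul_right])
  have exp0: "exp_ad vf_bracket N X 0 Y = Y"
  proof (cases N)
    \<comment> \<open>The sum is empty here, but then \<open>nil\<close> says that \<open>Y\<close>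
      itself is zero.\<close>
    case 0
    then show ?thesis using nil by (simp add: exp_ad_def)
  next
    case (Suc m)
    have "exp_ad vf_bracket N X 0 Y = (\<Sum>k\<in>{0}. ((- 0) ^ k / fact k) *\<^sub>R (vf_bracket X ^^ k) Y)"
      unfolding exp_ad_def Suc by (rule sum.mono_neutral_right) auto
    then show ?thesis by simp
  qed
  have "\<Phi> t = Y z"
    using e[of t] e[of 0] lin[of 0] \<gamma> by (simp add: exp0 integral_curve_def fd_mul_one)
  then have "fd (\<lambda>y. y \<otimes> \<gamma> t) z (Y z)
      = fd (\<lambda>y. y \<otimes> \<gamma> t) (z \<otimes> \<gamma> t \<otimes> \<gamma> (- t)) (fd (\<lambda>y. y \<otimes> \<gamma> (- t)) (z \<otimes> \<gamma> t) (exp_ad vf_bracket N X t Y (z \<otimes> \<gamma> t)))"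
    using integral_curve_minus[OF X(2) \<gamma>] lin[of t] by (simp add: m_assoc)
  also have "\<dots> = exp_ad vf_bracket N X t Y (z \<otimes> \<gamma> t)"
    using integral_curve_minus[OF X(2) \<gamma>] by (simp add: fd_mul_one flip: fd_mul_right_comp)
  finally show ?thesis .
qed

end

section \<open>Exponential coordinates and the moving frame\<close>

locale exponential_coordinates = euclidean_lie_group G
  for G :: "(real^'n::finite) monoid" (structure) +
  fixes idx :: "int \<Rightarrow> 'n" and X :: "int \<Rightarrow> real^'n \<Rightarrow> real^'n"
  assumes idx: "bij_betw idx {1..int CARD('n)} UNIV"
    and X_in: "\<And>l. l \<in> {1..int CARD('n)} \<Longrightarrow> X l \<in> lie_algebra G"
    and exp_coordinates: "exp_coordinates_second_type G idx X"
begin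

lemma idx_eq_iff: "k \<in> {1..int CARD('n)} \<Longrightarrow> l \<in> {1..int CARD('n)} \<Longrightarrow> idx k = idx l \<longleftrightarrow> k = l"
  using idx by (auto simp: bij_betw_def inj_on_def)

lemma foldl_mul_one: "(\<And>k. k \<in> set ls \<Longrightarrow> f k = \<one>) \<Longrightarrow> foldl (\<lambda>p l. p \<otimes> f l) p ls = p"
  by (induction ls arbitrary: p) auto

lemma split_range:
  assumes "l \<in> {1..int CARD('n)}"
  shows "rev [1..int CARD('n)] = rev [l+1..int CARD('n)] @ [l] @ rev [1..l-1]"
proof -
  have "[1..int CARD('n)] = [1..l-1] @ [l..int CARD('n)]"
    using assms by (intro upto_split1) auto
  also have "[l..int CARD('n)] = l # [l+1..int CARD('n)]"
    using assms by (intro upto_rec1) auto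
  finally show ?thesis by simp
qed

text \<open>On a coordinate axis all other coordinates vanish, so their factors are
  \<open>lie_exp G 0\<close>, the unit, and the product collapses to one factor.\<close>

lemma lie_exp_axis:
  assumes l: "l \<in> {1..int CARD('n)}"
  shows "lie_exp G (t *\<^sub>R X l) = axis (idx l) t"
proof -
  let ?f = "\<lambda>k. lie_exp G ((axis (idx l) t $ idx k) *\<^sub>R X k)"
  have one: "?f k = \<one>" if "k \<in> {1..int CARD('n)}" "k \<noteq> l" for k
    using that idx_eq_iff[OF that(1) l] by (simp add: axis_def lie_exp_zero)
  have fold: "foldl (\<lambda>p k. p \<otimes> ?f k) p (rev [l+1..int CARD('n)]) = p"
    "foldl (\<lambda>p k. p \<otimes> ?f k) p (rev [1..l-1]) = p" for p
    by (rule foldl_mul_one; use l in \<open>auto intro!: one\<close>)+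
  have "axis (idx l) t = foldl (\<lambda>p k. p \<otimes> ?f k) \<one> (rev [1..int CARD('n)])"
    using exp_coordinates by (simp add: exp_coordinates_second_type_def)
  also have "\<dots> = \<one> \<otimes> ?f l"
    unfolding split_range[OF l] foldl_append fold by (simp add: fold)
  finally show ?thesis by (simp add: axis_def)
qed

text \<open>The points \<open>axis (idx l) 1\<close> and \<open>axis (idx l) 2\<close> differ, which
  excludes the junk value of \<open>lie_exp\<close>: the coordinate hypothesis itself supplies the
  existence of the flow of \<open>X l\<close>.\<close>

lemma integral_curve_axis:
  assumes l: "l \<in> {1..int CARD('n)}"
  shows "integral_curve G (X l) (axis (idx l))"
  using lie_algebraD(2)[OF X_in[OF l]] lie_exp_axis[OF l]
  by (rule integral_curve_of_lie_exp) (simp add: axis_eq_axis)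

lemma foldl_axis: "foldl (\<lambda>p k. p \<otimes> axis (idx k) (x $ idx k)) \<one> (rev [1..int CARD('n)]) = x"
proof -
  have "foldl (\<lambda>p k. p \<otimes> axis (idx k) (x $ idx k)) \<one> (rev [1..int CARD('n)])
    = foldl (\<lambda>p k. p \<otimes> lie_exp G ((x $ idx k) *\<^sub>R X k)) \<one> (rev [1..int CARD('n)])"
    by (rule foldl_cong) (auto simp: lie_exp_axis)
  then show ?thesis using exp_coordinates by (simp add: exp_coordinates_second_type_def)
qed

end

text \<open>\<open>N\<close> is any bound on the nilpotency, not the smallest one: it is later
  chosen large enough to serve also as the truncation order for a given element of the
  prolongation.\<close>

locale nilpotent_exponential_coordinates = exponential_coordinates G idx X
  for G :: "(real^'n::finite) monoid" (structure) and idx X +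
  fixes N :: nat
  assumes subspace_lie_algebra: "subspace (lie_algebra G)"
    and vf_bracket_closed: "\<And>X Y. X \<in> lie_algebra G \<Longrightarrow> Y \<in> lie_algebra G \<Longrightarrow> vf_bracket X Y \<in> lie_algebra G"
    and nilpotent: "\<And>X Y. X \<in> lie_algebra G \<Longrightarrow> Y \<in> lie_algebra G \<Longrightarrow> (vf_bracket X ^^ N) Y = 0"
begin

lemma funpow_vf_bracket_closed:
  "W \<in> lie_algebra G \<Longrightarrow> Y \<in> lie_algebra G \<Longrightarrow> (vf_bracket W ^^ k) Y \<in> lie_algebra G"
  by (induction k) (auto intro: vf_bracket_closed)

lemma exp_ad_closed:
  "W \<in> lie_algebra G \<Longrightarrow> Y \<in> lie_algebra G \<Longrightarrow> exp_ad vf_bracket N W t Y \<in> lie_algebra G"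
  unfolding exp_ad_def
  by (intro subspace_sum subspace_scale subspace_lie_algebra funpow_vf_bracket_closed)

text \<open>The value at \<open>x\<close> of the field \<open>frame x l\<close> is the \<open>l\<close>-th coordinate vector: moving the \<open>l\<close>-th
  coordinate moves \<open>x = exp (x\<^sub>n X\<^sub>n) \<cdot> \<dots> \<cdot> exp (x\<^sub>1 X\<^sub>1)\<close> along \<open>X\<^sub>l\<close>, right translated by the factors
  with smaller indices.\<close>

definition frame :: "real^'n \<Rightarrow> int \<Rightarrow> real^'n \<Rightarrow> real^'n"
  where "frame x l = foldl (\<lambda>Y k. exp_ad vf_bracket N (X k) (x $ idx k) Y) (X l) (rev [1..l-1])"

lemma foldl_exp_ad_closed:
  "Y \<in> lie_algebra G \<Longrightarrow> set ls \<subseteq> {1..int CARD('n)} \<Longrightarrow>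
    foldl (\<lambda>Y k. exp_ad vf_bracket N (X k) (x $ idx k) Y) Y ls \<in> lie_algebra G"
  by (induction ls arbitrary: Y) (auto simp: exp_ad_closed X_in)

lemma frame_closed: "l \<in> {1..int CARD('n)} \<Longrightarrow> frame x l \<in> lie_algebra G"
  unfolding frame_def by (intro foldl_exp_ad_closed X_in) auto

text \<open>After each right translation the velocity is again the value of a left-invariant field:
  \<open>fd_mul_right_exp_ad\<close> replaces \<open>Y\<close> by its \<open>exp_ad\<close>
  transform, to which the induction hypothesis applies.\<close>

lemma foldl_mul_derivative:
  assumes "Y \<in> lie_algebra G" "set ls \<subseteq> {1..int CARD('n)}"
    and "(c has_vector_derivative Y (c t)) (at t)"
  shows "((\<lambda>t. foldl (\<lambda>p k. p \<otimes> axis (idx k) (x $ idx k)) (c t) ls) has_vector_derivative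
    foldl (\<lambda>Y k. exp_ad vf_bracket N (X k) (x $ idx k) Y) Y ls
      (foldl (\<lambda>p k. p \<otimes> axis (idx k) (x $ idx k)) (c t) ls)) (at t)"
  using assms
proof (induction ls arbitrary: Y c)
  case (Cons k ls)
  have k: "k \<in> {1..int CARD('n)}" using Cons.prems by simp
  have "((\<lambda>t. c t \<otimes> axis (idx k) (x $ idx k)) has_vector_derivative
      exp_ad vf_bracket N (X k) (x $ idx k) Y (c t \<otimes> axis (idx k) (x $ idx k))) (at t)"
    using right_translate[OF Cons.prems(3), of "axis (idx k) (x $ idx k)"]
      fd_mul_right_exp_ad[OF lie_algebraD[OF X_in[OF k]] integral_curve_axis[OF k]
        lie_algebraD(1)[OF funpow_vf_bracket_closed] nilpotent, of Y "x $ idx k" "c t"]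
      Cons.prems(1) X_in[OF k] by simp
  then show ?case
    using Cons.IH[of "exp_ad vf_bracket N (X k) (x $ idx k) Y"] Cons.prems exp_ad_closed X_in by simp
qed simp

lemma frame_eq_axis:
  assumes l: "l \<in> {1..int CARD('n)}"
  shows "frame x l x = axis (idx l) 1"
proof -
  let ?m = "\<lambda>y p k. p \<otimes> axis (idx k) (y $ idx k)"
  \<comment> \<open>\<open>?y t\<close> is \<open>x\<close> with its \<open>l\<close>-th coordinate
    replaced by \<open>t\<close>.\<close>
  let ?y = "\<lambda>t. x + axis (idx l) (t - x $ idx l)"
  define a where "a = foldl (?m x) \<one> (rev [l+1..int CARD('n)])"
  define F where "F t = foldl (?m x) (a \<otimes> axis (idx l) t) (rev [1..l-1])" for t
  have coords: "x $ idx k + axis (idx l) (t - x $ idx l) $ idx k = (if k = l then t else x $ idx k)" if "k \<in> {1..int CARD('n)}" for k t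
    using idx_eq_iff[OF that l] by (simp add: axis_def)
  have F: "F t = ?y t" for t
  proof -
    have "?y t = foldl (?m (?y t)) \<one> (rev [1..int CARD('n)])"
      by (rule foldl_axis[symmetric])
    also have "\<dots> = foldl (?m (?y t)) (foldl (?m (?y t)) \<one> (rev [l+1..int CARD('n)]) \<otimes> axis (idx l) t) (rev [1..l-1])"
      unfolding split_range[OF l] using coords[OF l] by simp
    also have "foldl (?m (?y t)) \<one> (rev [l+1..int CARD('n)]) = a"
      unfolding a_def using l by (intro foldl_cong) (auto simp: coords)
    also have "foldl (?m (?y t)) (a \<otimes> axis (idx l) t) (rev [1..l-1]) = F t"
      unfolding F_def using l by (intro foldl_cong) (auto simp: coords)
    finally show ?thesis ..
  qed
  have "((\<lambda>t. a \<otimes> axis (idx l) t) has_vector_derivative X l (a \<otimes> axis (idx l) t)) (at t)" for t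
    using left_invariant_translate[OF lie_algebraD(2)[OF X_in[OF l]]] integral_curve_axis[OF l]
    by (simp add: integral_curve_def)
  from foldl_mul_derivative[OF X_in[OF l] _ this, of "rev [1..l-1]" x "x $ idx l"] l
  have "(F has_vector_derivative frame x l (F (x $ idx l))) (at (x $ idx l))"
    by (simp add: F_def[abs_def] frame_def)
  moreover have "F (x $ idx l) = x"
    by (simp add: F vec_eq_iff axis_def)
  \<comment> \<open>The same curve is a straight line in the coordinates; comparing its two
    velocities identifies the value of the frame.\<close>
  moreover have "(F has_vector_derivative axis (idx l) 1) (at (x $ idx l))"
  proof -
    have "?y t = x + (t - x $ idx l) *\<^sub>R axis (idx l) 1" for t
      by (simp add: vec_eq_iff axis_def)
    then have "F = (\<lambda>t. x + (t - x $ idx l) *\<^sub>R axis (idx l) 1)"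
      by (simp add: F fun_eq_iff)
    then show ?thesis by (auto intro!: derivative_eq_intros)
  qed
  ultimately show ?thesis
    using vector_derivative_unique_at by metis
qed

text \<open>A left-invariant field is determined by its value at one point.\<close>

lemma lie_algebra_frame:
  assumes W: "W \<in> lie_algebra G"
  shows "W = (\<Sum>l=1..int CARD('n). (W x $ idx l) *\<^sub>R frame x l)"
proof -
  define V where "V = W - (\<Sum>l=1..int CARD('n). (W x $ idx l) *\<^sub>R frame x l)"
  have "V \<in> lie_algebra G"
    unfolding V_def by (intro subspace_diff subspace_sum subspace_scale subspace_lie_algebra W frame_closed)
  have "W x = (\<Sum>j\<in>UNIV. (W x $ j) *\<^sub>R axis j 1)"
    by (simp add: vec_eq_iff axis_def if_distrib cong: if_cong)
  also have "\<dots> = (\<Sum>l=1..int CARD('n). (W x $ idx l) *\<^sub>R axis (idx l) 1)"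
    by (rule sum.reindex_bij_betw[OF idx, symmetric])
  also have "\<dots> = (\<Sum>l=1..int CARD('n). (W x $ idx l) *\<^sub>R frame x l x)"
    by (intro sum.cong) (simp_all add: frame_eq_axis)
  finally have "V x = 0"
    by (simp add: V_def sum_fun_apply scaleR_fun_def)
  have "V y = 0" for y
  proof -
    have "V y = V ((y \<otimes> inv x) \<otimes> x)" by (simp add: m_assoc)
    also have "\<dots> = 0"
      using left_invariant_eq[OF lie_algebraD(2)[OF \<open>V \<in> lie_algebra G\<close>]] \<open>V x = 0\<close>
        linear_0[OF linear_fd_mul] by (simp add: zero_prod_def)
    finally show ?thesis .
  qed
  then have "V = 0" by (simp add: fun_eq_iff)
  then show ?thesis by (simp add: V_def)
qed

end

section \<open>Brackets in the prolongation\<close>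

lemma linear_funpow: "linear f \<Longrightarrow> linear (f ^^ k)" for f :: "'a::real_vector \<Rightarrow> 'a"
proof (induction k)
  case 0
  then show ?case by (simp add: linear_ident)
next
  case (Suc k)
  then show ?case using linear_compose[of "f ^^ k" f] by (simp add: o_def)
qed

lemma linear_foldl:
  fixes f :: "'a::real_vector \<Rightarrow> 'b \<Rightarrow> 'a"
  assumes "\<And>l. l \<in> set ls \<Longrightarrow> linear (\<lambda>u. f u l)"
  shows "linear (\<lambda>u. foldl f u ls)"
  using assms
proof (induction ls)
  case Nil
  then show ?case by (simp add: linear_ident)
next
  case (Cons l ls)
  then show ?case
    using linear_compose[of "\<lambda>u. f u l" "\<lambda>u. foldl f u ls"] by (simp add: o_def)
qed

lemma linear_prol_app: "linear (\<lambda>u. prol_app u Z)"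
  by (rule linearI) (auto simp: prol_app_def scaleR_fun_def)

lemma prol_app_zero [simp]: "prol_app 0 Z = 0"
  by (simp add: prol_app_def fun_eq_iff)

text \<open>The truncated series of \<open>exp (t ad X)\<close>: as \<^const>\<open>prol_app\<close> brackets on the right, it is
  minus the adjoint action.\<close>

definition exp_app :: "nat \<Rightarrow> 'v::real_vector \<Rightarrow> real \<Rightarrow> 'v prol \<Rightarrow> 'v prol"
  where "exp_app N X t u = (\<Sum>k<N. ((- t) ^ k / fact k) *\<^sub>R ((\<lambda>w. prol_app w X) ^^ k) u)"

lemma linear_exp_app: "linear (exp_app N X t)"
proof (rule linearI)
  note lin = linear_funpow[OF linear_prol_app]
  show "exp_app N X t (u + w) = exp_app N X t u + exp_app N X t w" for u w
    by (simp add: exp_app_def linear_add[OF lin] scaleR_add_right sum.distrib)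
  show "exp_app N X t (c *\<^sub>R u) = c *\<^sub>R exp_app N X t u" for c u
    by (simp add: exp_app_def linear_scale[OF lin] scaleR_sum_right mult.commute)
qed

text \<open>All iterated brackets of \<open>u\<close> with at least \<open>m\<close> elements vanish.\<close>

definition vanishing :: "nat \<Rightarrow> 'v::real_vector prol \<Rightarrow> bool"
  where "vanishing m u \<longleftrightarrow> (\<forall>zs. m \<le> length zs \<longrightarrow> u zs = 0)"

lemma vanishing_0: "vanishing 0 u \<longleftrightarrow> u = 0"
  by (auto simp: vanishing_def)

lemma vanishing_mono: "vanishing m u \<Longrightarrow> m \<le> m' \<Longrightarrow> vanishing m' u"
  by (auto simp: vanishing_def)

lemma subspace_vanishing: "subspace {u. vanishing m u}"
  by (rule subspaceI) (auto simp: vanishing_def scaleR_fun_def)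

lemma vanishing_prol_app: "vanishing m u \<Longrightarrow> vanishing (m - 1) (prol_app u Z)"
  by (auto simp: vanishing_def prol_app_def)

lemma vanishing_funpow: "vanishing m u \<Longrightarrow> vanishing (m - k) (((\<lambda>w. prol_app w X) ^^ k) u)"
proof (induction k)
  case (Suc k)
  then show ?case using vanishing_prol_app[of "m - k"] by fastforce
qed simp

lemma vanishing_exp_app:
  assumes "vanishing m u"
  shows "vanishing m (exp_app N X t u)"
proof -
  have "((\<lambda>w. prol_app w X) ^^ k) u \<in> {u. vanishing m u}" for k
    using vanishing_mono[OF vanishing_funpow[OF assms]] by simp
  then have "exp_app N X t u \<in> {u. vanishing m u}"
    unfolding exp_app_def by (intro subspace_sum subspace_scale subspace_vanishing)
  then show ?thesis by simp
qed

text \<open>The axioms are stated relative to \<open>L\<close> because the ambient type contains all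
  functions, and \<open>vf_bracket\<close> has no controlled value on non-differentiable
  ones.\<close>

locale stratified_lie_algebra =
  fixes L :: "'v::real_vector set" and br :: "'v \<Rightarrow> 'v \<Rightarrow> 'v" and S :: "int \<Rightarrow> 'v set" and s :: int
  assumes stratification: "stratification L br S s"
    and br_add_left: "\<And>X Y Z. X \<in> L \<Longrightarrow> Y \<in> L \<Longrightarrow> Z \<in> L \<Longrightarrow> br (X + Y) Z = br X Z + br Y Z"
    and br_scale_left: "\<And>c X Z. X \<in> L \<Longrightarrow> Z \<in> L \<Longrightarrow> br (c *\<^sub>R X) Z = c *\<^sub>R br X Z"
    and br_antisym: "\<And>X Y. X \<in> L \<Longrightarrow> Y \<in> L \<Longrightarrow> br X Y = - br Y X"
    and br_jacobi: "\<And>X Y Z. X \<in> L \<Longrightarrow> Y \<in> L \<Longrightarrow> Z \<in> L \<Longrightarrow>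
      br X (br Y Z) = br (br X Y) Z - br (br X Z) Y"
begin

lemma s_ge_1: "1 \<le> s"
  and subspace_S: "1 \<le> i \<Longrightarrow> subspace (S i)"
  and span_S: "span (\<Union>i\<in>{1..s}. S i) = L"
  and S_direct: "\<lbrakk>\<forall>i\<in>{1..s}. x i \<in> S i; (\<Sum>i=1..s. x i) = 0\<rbrakk> \<Longrightarrow> \<forall>i\<in>{1..s}. x i = 0"
  and S_rec: "2 \<le> i \<Longrightarrow> S i = span {br X Y | X Y. X \<in> S (i - 1) \<and> Y \<in> S 1}"
  and S_zero: "s < i \<Longrightarrow> S i = {0}"
  using stratification by (auto simp: stratification_def)

lemma subspace_L: "subspace L"
  using span_S subspace_span by metis

lemmas L_closed = subspace_0[OF subspace_L] subspace_add[OF subspace_L]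
  subspace_diff[OF subspace_L] subspace_scale[OF subspace_L] subspace_neg[OF subspace_L]

lemma S_subset_L: "1 \<le> i \<Longrightarrow> X \<in> S i \<Longrightarrow> X \<in> L"
proof (cases "i \<le> s")
  case True
  assume "1 \<le> i" "X \<in> S i"
  with True have "X \<in> (\<Union>i\<in>{1..s}. S i)" by auto
  from span_base[OF this] show ?thesis by (simp only: span_S)
next
  case False
  assume "1 \<le> i" "X \<in> S i"
  with False show ?thesis by (simp add: S_zero L_closed)
qed

lemma L_induct [consumes 1, case_names stratum zero add scale]:
  assumes "Z \<in> L"
    and base: "\<And>i Z. i \<in> {1..s} \<Longrightarrow> Z \<in> S i \<Longrightarrow> P Z"
    and zero: "P 0"
    and add: "\<And>X Y. X \<in> L \<Longrightarrow> Y \<in> L \<Longrightarrow> P X \<Longrightarrow> P Y \<Longrightarrow> P (X + Y)"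
    and scale: "\<And>c X. X \<in> L \<Longrightarrow> P X \<Longrightarrow> P (c *\<^sub>R X)"
  shows "P Z"
proof -
  have "subspace {Z \<in> L. P Z}"
    by (rule subspaceI) (auto simp: L_closed zero add scale)
  then have "span (\<Union>i\<in>{1..s}. S i) \<subseteq> {Z \<in> L. P Z}"
    by (intro span_minimal) (auto intro: base S_subset_L)
  then show ?thesis using assms(1) span_S by auto
qed

lemma br_add_right: "X \<in> L \<Longrightarrow> Y \<in> L \<Longrightarrow> Z \<in> L \<Longrightarrow> br Z (X + Y) = br Z X + br Z Y"
  by (metis L_closed(2) br_add_left br_antisym minus_add_distrib)

lemma br_scale_right: "X \<in> L \<Longrightarrow> Z \<in> L \<Longrightarrow> br Z (c *\<^sub>R X) = c *\<^sub>R br Z X"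
  by (metis L_closed(4) br_scale_left br_antisym scaleR_minus_right)

lemma br_zero: "X \<in> L \<Longrightarrow> br 0 X = 0" "X \<in> L \<Longrightarrow> br X 0 = 0"
  using br_scale_left[of X X 0] br_scale_right[of X X 0] by auto

text \<open>Generation gives the rule for a second factor of degree one. As \<open>S (j + 1)\<close>
  is spanned by brackets \<open>[Y, Z]\<close> with \<open>Z\<close> in \<open>S 1\<close>, the
  Jacobi identity reduces degree \<open>j + 1\<close> to degree \<open>j\<close>; the induction runs
  over all \<open>i\<close> at once because \<open>[X, Z]\<close> has degree
  \<open>i + 1\<close>.\<close>

lemma br_stratum: "1 \<le> i \<Longrightarrow> 1 \<le> j \<Longrightarrow> X \<in> S i \<Longrightarrow> Y \<in> S j \<Longrightarrow> br X Y \<in> S (i + j)"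
proof -
  have base: "br X Y \<in> S (i + 1)" if "1 \<le> i" "X \<in> S i" "Y \<in> S 1" for i X Y
    using S_rec[of "i + 1"] that by (auto intro!: span_base)
  have "\<forall>i X Y. 1 \<le> i \<longrightarrow> X \<in> S i \<longrightarrow> Y \<in> S j \<longrightarrow> br X Y \<in> S (i + j)" if "1 \<le> j" for j
    using that
  proof (induction j rule: int_ge_induct)
    case (step j)
    show ?case
    proof (intro allI impI)
      fix i X Y assume i: "1 \<le> i" and X: "X \<in> S i" and Y: "Y \<in> S (j + 1)"
      have XL: "X \<in> L" using i X S_subset_L by blast
      have S_sub: "subspace (S (i + (j + 1)))" using i step by (intro subspace_S) simp
      have gen: "br X (br Y Z) \<in> S (i + (j + 1))" if "Y \<in> S j" "Z \<in> S 1" for Y Z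
      proof -
        have YZ: "Y \<in> L" "Z \<in> L" using that step S_subset_L[of j Y] S_subset_L[of 1 Z] by auto
        have "br (br X Y) Z \<in> S (i + j + 1)" "br (br X Z) Y \<in> S (i + 1 + j)"
          using step i X that base by auto
        then show ?thesis
          using XL YZ subspace_diff[OF S_sub] by (simp add: br_jacobi add.assoc add.commute[of 1])
      qed
      have "subspace {Y \<in> L. br X Y \<in> S (i + (j + 1))}"
        by (rule subspaceI)
          (auto simp: XL L_closed br_zero br_add_right br_scale_right
            intro: subspace_0 subspace_add subspace_scale S_sub)
      moreover have "{br Y Z |Y Z. Y \<in> S j \<and> Z \<in> S 1} \<subseteq> {Y \<in> L. br X Y \<in> S (i + (j + 1))}"
        using gen base step by (auto intro!: S_subset_L[of "j + 1"])
      ultimately have "S (j + 1) \<subseteq> {Y \<in> L. br X Y \<in> S (i + (j + 1))}"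
        using step S_rec[of "j + 1"] span_minimal by simp
      then show "br X Y \<in> S (i + (j + 1))" using Y by auto
    qed
  qed (use base in auto)
  then show "1 \<le> i \<Longrightarrow> 1 \<le> j \<Longrightarrow> X \<in> S i \<Longrightarrow> Y \<in> S j \<Longrightarrow> br X Y \<in> S (i + j)" by blast
qed

lemma br_closed: "X \<in> L \<Longrightarrow> Y \<in> L \<Longrightarrow> br X Y \<in> L"
proof (induction X rule: L_induct)
  case (stratum i X)
  then have XL: "X \<in> L" by (auto intro: S_subset_L)
  show ?case
    using \<open>Y \<in> L\<close>
  proof (induction Y rule: L_induct)
    case (stratum j Y)
    then show ?case
      using br_stratum[of i j X Y] S_subset_L[of "i + j"] \<open>i \<in> {1..s}\<close> \<open>X \<in> S i\<close> by auto
  qed (auto simp: XL L_closed br_zero br_add_right br_scale_right)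
qed (auto simp: L_closed br_zero br_add_left br_scale_left)

section \<open>The strata of the prolongation and their span\<close>

abbreviation P :: "int \<Rightarrow> 'v prol set" where "P k \<equiv> prol_stratum L br S s k"
abbreviation emb :: "'v \<Rightarrow> 'v prol" where "emb \<equiv> prol_emb L br"

definition Prol :: "'v prol set"
  where "Prol = span (\<Union>k\<in>{..s}. P k)"

lemma foldl_br_closed: "X \<in> L \<Longrightarrow> set zs \<subseteq> L \<Longrightarrow> foldl br X zs \<in> L"
  by (induction zs arbitrary: X) (auto simp: br_closed)

lemma foldl_br_add:
  "X \<in> L \<Longrightarrow> Y \<in> L \<Longrightarrow> set zs \<subseteq> L \<Longrightarrow> foldl br (X + Y) zs = foldl br X zs + foldl br Y zs"
  by (induction zs arbitrary: X Y) (auto simp: br_closed br_add_left)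

lemma foldl_br_scale: "X \<in> L \<Longrightarrow> set zs \<subseteq> L \<Longrightarrow> foldl br (c *\<^sub>R X) zs = c *\<^sub>R foldl br X zs"
  by (induction zs arbitrary: X) (auto simp: br_closed br_scale_left)

lemma emb_add: "X \<in> L \<Longrightarrow> Y \<in> L \<Longrightarrow> emb (X + Y) = emb X + emb Y"
  by (auto simp: prol_emb_def foldl_br_add)

lemma emb_scale: "X \<in> L \<Longrightarrow> emb (c *\<^sub>R X) = c *\<^sub>R emb X"
  by (auto simp: prol_emb_def foldl_br_scale scaleR_fun_def)

lemma emb_zero: "emb 0 = 0"
  using emb_scale[of 0 0] L_closed by simp

lemma emb_minus: "X \<in> L \<Longrightarrow> emb (- X) = - emb X"
  using emb_scale[of X "- 1"] by simp

lemma emb_Nil [simp]: "emb X [] = X"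
  by (simp add: prol_emb_def)

lemma prol_app_emb: "prol_app (emb X) Z = (if Z \<in> L then emb (br X Z) else 0)"
  by (auto simp: prol_emb_def prol_app_def)

lemma stratum_pos: "1 \<le> k \<Longrightarrow> P k = emb ` S k"
  by (subst prol_stratum.simps) simp

lemma stratum_zero: "s < k \<Longrightarrow> P k = {0}"
  using s_ge_1 by (simp add: stratum_pos S_zero emb_zero)

text \<open>In degree at most \<open>0\<close> this fact and the next ones come from the defining
  clauses; in positive degree they are properties of the bracket of \<open>L\<close>. Together they
  free later arguments from a case distinction on the sign of the degree.\<close>

lemma stratum_Nil: "u \<in> P k \<Longrightarrow> u [] \<in> L"
  by (cases "1 \<le> k") (auto simp: stratum_pos L_closed S_subset_L prol_stratum.simps[of _ _ _ _ k])

lemma stratum_app_outside: "u \<in> P k \<Longrightarrow> Z \<notin> L \<Longrightarrow> prol_app u Z = 0"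
  by (cases "1 \<le> k") (auto simp: stratum_pos prol_app_emb prol_stratum.simps[of _ _ _ _ k])

lemma stratum_app_linear:
  assumes "u \<in> P k" "X \<in> L" "Y \<in> L"
  shows "prol_app u (a *\<^sub>R X + b *\<^sub>R Y) = a *\<^sub>R prol_app u X + b *\<^sub>R prol_app u Y"
proof (cases "1 \<le> k")
  case True
  then obtain W where W: "u = emb W" "W \<in> L"
    using assms S_subset_L by (auto simp: stratum_pos)
  then show ?thesis
    using assms by (simp add: prol_app_emb L_closed br_add_right br_scale_right br_closed emb_add emb_scale)
next
  case False
  then show ?thesis
    using assms(1)[unfolded prol_stratum.simps[of _ _ _ _ k]] assms(2,3) by simp
qed

lemma stratum_app:
  assumes "u \<in> P k" "i \<in> {1..s}" "X \<in> S i"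
  shows "prol_app u X \<in> P (k + i)"
proof (cases "1 \<le> k")
  case True
  then obtain W where W: "u = emb W" "W \<in> S k"
    using assms by (auto simp: stratum_pos)
  then show ?thesis
    using True assms S_subset_L[of i X] br_stratum[of k i W X] by (auto simp: prol_app_emb stratum_pos)
next
  case False
  then show ?thesis
    using assms(1)[unfolded prol_stratum.simps[of _ _ _ _ k]] assms(2,3) by simp
qed

lemma stratum_app_br:
  assumes "u \<in> P k" "X \<in> L" "Y \<in> L"
  shows "prol_app u (br X Y) = prol_app (prol_app u X) Y - prol_app (prol_app u Y) X"
proof (cases "1 \<le> k")
  case True
  then obtain W where W: "u = emb W" "W \<in> L"
    using assms S_subset_L by (auto simp: stratum_pos)
  have "emb (br (br W X) Y) = emb (br W (br X Y)) + emb (br (br W Y) X)"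
    using W(2) assms emb_add[of "br W (br X Y)" "br (br W Y) X"] by (simp add: br_closed br_jacobi L_closed)
  then show ?thesis
    using W assms by (simp add: prol_app_emb br_closed)
next
  case False
  then show ?thesis
    using assms(1)[unfolded prol_stratum.simps[of _ _ _ _ k]] assms(2,3) by simp
qed

lemma subspace_Prol: "subspace Prol"
  by (simp add: Prol_def)

lemmas Prol_closed = subspace_0[OF subspace_Prol] subspace_add[OF subspace_Prol]
  subspace_diff[OF subspace_Prol] subspace_scale[OF subspace_Prol] subspace_neg[OF subspace_Prol]

lemma stratum_subset_Prol: "u \<in> P k \<Longrightarrow> u \<in> Prol"
proof (cases "k \<le> s")
  case True
  assume "u \<in> P k"
  with True show ?thesis unfolding Prol_def by (intro span_base) auto
next
  case False
  assume "u \<in> P k"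
  with False show ?thesis by (simp add: stratum_zero Prol_closed)
qed

lemma Prol_induct [consumes 1, case_names stratum zero add scale]:
  assumes "u \<in> Prol"
    and base: "\<And>k u. u \<in> P k \<Longrightarrow> Q u"
    and zero: "Q 0"
    and add: "\<And>u w. u \<in> Prol \<Longrightarrow> w \<in> Prol \<Longrightarrow> Q u \<Longrightarrow> Q w \<Longrightarrow> Q (u + w)"
    and scale: "\<And>c u. u \<in> Prol \<Longrightarrow> Q u \<Longrightarrow> Q (c *\<^sub>R u)"
  shows "Q u"
proof -
  have "subspace {u \<in> Prol. Q u}"
    by (rule subspaceI) (auto simp: Prol_closed zero add scale)
  then have "Prol \<subseteq> {u \<in> Prol. Q u}"
    by (subst Prol_def, intro span_minimal) (auto intro: base stratum_subset_Prol)
  then show ?thesis using assms(1) by auto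
qed

lemma emb_Prol: "X \<in> L \<Longrightarrow> emb X \<in> Prol"
proof (induction X rule: L_induct)
  case (stratum i Z)
  then show ?case using stratum_subset_Prol[of "emb Z" i] by (auto simp: stratum_pos)
qed (simp_all only: emb_zero emb_add emb_scale Prol_closed)

lemma Prol_Nil: "u \<in> Prol \<Longrightarrow> u [] \<in> L"
  by (induction u rule: Prol_induct) (auto simp: L_closed stratum_Nil scaleR_fun_def)

lemmas prol_app_add = linear_add[OF linear_prol_app]
lemmas prol_app_scale = linear_scale[OF linear_prol_app]

lemma Prol_app_outside: "u \<in> Prol \<Longrightarrow> Z \<notin> L \<Longrightarrow> prol_app u Z = 0"
  by (induction u rule: Prol_induct) (auto simp: stratum_app_outside prol_app_add prol_app_scale)

lemma Prol_app_linear: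
  assumes "u \<in> Prol" "X \<in> L" "Y \<in> L"
  shows "prol_app u (a *\<^sub>R X + b *\<^sub>R Y) = a *\<^sub>R prol_app u X + b *\<^sub>R prol_app u Y"
  using assms
  by (induction u rule: Prol_induct)
    (auto simp: stratum_app_linear prol_app_add prol_app_scale scaleR_add_right mult.commute)

lemma Prol_app_add: "u \<in> Prol \<Longrightarrow> X \<in> L \<Longrightarrow> Y \<in> L \<Longrightarrow> prol_app u (X + Y) = prol_app u X + prol_app u Y"
  using Prol_app_linear[of u X Y 1 1] by simp

lemma Prol_app_scale: "u \<in> Prol \<Longrightarrow> X \<in> L \<Longrightarrow> prol_app u (c *\<^sub>R X) = c *\<^sub>R prol_app u X"
  using Prol_app_linear[of u X X c 0] by simp

lemma Prol_app_0: "u \<in> Prol \<Longrightarrow> prol_app u 0 = 0"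
  using Prol_app_scale[of u 0 0] L_closed by simp

lemma Prol_app_sum:
  assumes "u \<in> Prol" "\<And>a. a \<in> A \<Longrightarrow> f a \<in> L"
  shows "prol_app u (\<Sum>a\<in>A. c a *\<^sub>R f a) = (\<Sum>a\<in>A. c a *\<^sub>R prol_app u (f a))"
  using assms(2)
proof (induction A rule: infinite_finite_induct)
  case (insert a A)
  then have "(\<Sum>a\<in>A. c a *\<^sub>R f a) \<in> L"
    by (intro subspace_sum subspace_scale subspace_L) auto
  then show ?case
    using insert assms(1) by (simp add: Prol_app_add Prol_app_scale L_closed)
qed (auto simp: Prol_app_0 assms(1))

lemma Prol_app_br:
  assumes "u \<in> Prol" "X \<in> L" "Y \<in> L"
  shows "prol_app u (br X Y) = prol_app (prol_app u X) Y - prol_app (prol_app u Y) X"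
  using assms
  by (induction u rule: Prol_induct)
    (auto simp: stratum_app_br prol_app_add prol_app_scale scaleR_diff_right)

lemma Prol_app: "u \<in> Prol \<Longrightarrow> prol_app u Z \<in> Prol"
proof (cases "Z \<in> L")
  case True
  assume "u \<in> Prol"
  then show ?thesis
  proof (induction u rule: Prol_induct)
    case (stratum k u)
    note u = stratum_subset_Prol[OF stratum]
    show ?case
      using True
    proof (induction Z rule: L_induct)
      case (stratum i Z)
      then show ?case using stratum_app \<open>u \<in> P k\<close> stratum_subset_Prol by blast
    qed (simp_all only: Prol_app_0 Prol_app_add Prol_app_scale u Prol_closed)
  qed (simp_all only: prol_app_zero prol_app_add prol_app_scale Prol_closed)
next
  case False
  assume "u \<in> Prol"
  with False show ?thesis by (simp add: Prol_app_outside Prol_closed)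
qed

lemma Prol_funpow: "u \<in> Prol \<Longrightarrow> ((\<lambda>w. prol_app w X) ^^ k) u \<in> Prol"
  by (induction k) (auto simp: Prol_app)

lemma Prol_exp_app: "u \<in> Prol \<Longrightarrow> exp_app N X t u \<in> Prol"
  unfolding exp_app_def by (intro subspace_sum subspace_scale subspace_Prol Prol_funpow)

lemma Prol_nonpos: "u \<in> Prol \<Longrightarrow> prol_nonpos L br u \<in> Prol"
  unfolding prol_nonpos_def by (intro Prol_closed emb_Prol Prol_Nil)

text \<open>A bracket with an element of \<open>S i\<close> raises the degree by
  \<open>i \<ge> 1\<close>, so after \<open>s - k + 1\<close> brackets the degree exceeds
  \<open>s\<close>, where the strata are zero.\<close>

lemma stratum_vanishing: "u \<in> P k \<Longrightarrow> vanishing (nat (s - k + 1)) u"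
proof -
  have "u \<in> P k \<Longrightarrow> nat (s - k + 1) \<le> length zs \<Longrightarrow> u zs = 0" for zs k u
  proof (induction zs arbitrary: u k)
    case Nil
    then have "s < k" by simp
    then show ?case using Nil by (simp add: stratum_zero)
  next
    case (Cons Z zs)
    note u = stratum_subset_Prol[OF Cons.prems(1)]
    have "prol_app u Z zs = 0"
    proof (cases "Z \<in> L")
      case True
      then show ?thesis
      proof (induction Z rule: L_induct)
        case (stratum i Z)
        then have "nat (s - (k + i) + 1) \<le> length zs"
          using Cons.prems(2) by (auto simp: nat_le_iff)
        then show ?case using Cons.IH stratum_app[OF Cons.prems(1) stratum] by blast
      qed (auto simp: Prol_app_0 Prol_app_add Prol_app_scale u scaleR_fun_def)
    next
      case False
      then show ?thesis using u by (simp add: Prol_app_outside)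
    qed
    then show ?case by (simp add: prol_app_def)
  qed
  then show "u \<in> P k \<Longrightarrow> vanishing (nat (s - k + 1)) u"
    by (simp add: vanishing_def)
qed

text \<open>The bound depends on the element: the one for a stratum grows as the degree decreases,
  and an element is a finite sum of homogeneous ones.\<close>

lemma Prol_vanishing: "u \<in> Prol \<Longrightarrow> \<exists>m. vanishing m u"
proof (induction u rule: Prol_induct)
  case (add u w)
  then obtain m m' where "vanishing m u" "vanishing m' w" by blast
  then show ?case by (intro exI[of _ "max m m'"]) (auto simp: vanishing_def)
next
  case (scale c u)
  then show ?case by (auto simp: vanishing_def scaleR_fun_def)
next
  case zero
  show ?case by (rule exI[of _ 0]) (simp only: vanishing_0)
qed (blast intro: stratum_vanishing)

lemma vanishing_emb: "X \<in> L \<Longrightarrow> vanishing (nat s) (emb X)"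
proof (induction X rule: L_induct)
  case (stratum i Z)
  then have "vanishing (nat (s - i + 1)) (emb Z)"
    by (intro stratum_vanishing) (auto simp: stratum_pos)
  then show ?case by (rule vanishing_mono) (use stratum in auto)
qed (auto simp: emb_zero emb_add emb_scale vanishing_def scaleR_fun_def)

lemma funpow_br_closed: "X \<in> L \<Longrightarrow> Y \<in> L \<Longrightarrow> (br X ^^ k) Y \<in> L"
  by (induction k) (auto intro: br_closed)

text \<open>\<open>br X\<close> brackets on the left while \<open>prol_emb\<close> stores brackets
  on the right: up to the sign \<open>(- 1) ^ N\<close> the power is the value of
  \<open>emb Y\<close> at \<open>replicate N X\<close>, a list long enough for it to vanish.\<close>

lemma funpow_br_eq_0:
  assumes "X \<in> L" "Y \<in> L" "nat s \<le> N"
  shows "(br X ^^ N) Y = 0"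
proof -
  have eq: "(br X ^^ k) Y = (- 1) ^ k *\<^sub>R foldl br Y (replicate k X)" for k
  proof (induction k)
    case (Suc k)
    have "foldl br Y (replicate k X) \<in> L"
      using assms by (intro foldl_br_closed) auto
    moreover have "foldl br Y (replicate (Suc k) X) = br (foldl br Y (replicate k X)) X"
      unfolding replicate_Suc replicate_append_same[symmetric] by simp
    ultimately show ?case
      using Suc assms br_antisym[of X "foldl br Y (replicate k X)"] by (simp add: br_scale_right)
  qed simp
  have "emb Y (replicate N X) = 0"
    using vanishing_emb[OF assms(2)] assms(3) by (simp add: vanishing_def)
  then show ?thesis
    using assms(1) by (simp add: eq prol_emb_def) (metis UNIV_I empty_iff insert_iff set_replicate_conv_if singletonD subsetI)
qed

section \<open>The full bracket with one factor in the Lie algebra\<close>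

lemma prol_bracket_zero:
  "u \<in> Prol \<Longrightarrow> prol_bracket L br u 0 zs = 0 \<and> prol_bracket L br 0 u zs = 0"
proof (induction zs arbitrary: u)
  case (Nil u)
  have "prol_nonpos L br 0 = 0" by (simp add: prol_nonpos_def emb_zero)
  then show ?case
    using Nil by (simp only: prol_bracket.simps[of _ _ _ _ "[]"])
      (simp add: br_zero Prol_Nil emb_zero Prol_app_0 Prol_nonpos)
next
  case (Cons Z zs)
  have "prol_nonpos L br 0 = 0" by (simp add: prol_nonpos_def emb_zero)
  moreover have "prol_bracket L br u 0 zs = 0" "prol_bracket L br 0 u zs = 0" if "u \<in> Prol" for u
    using Cons.IH[OF that] by blast+
  ultimately show ?case
    using Cons.prems by (simp only: prol_bracket.simps[of _ _ _ _ "Z # zs"])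
      (simp add: br_zero Prol_Nil emb_zero Prol_app_0 Prol_nonpos Prol_app)
qed

lemma prol_nonpos_emb: "prol_nonpos L br (emb X) = 0"
  by (simp add: prol_nonpos_def)

text \<open>\<open>emb Y\<close> has no part of degree at most \<open>0\<close>, so the recursive
  terms of \<open>prol_bracket\<close> are zero; what remains is the sum of the values at
  \<open>Y\<close> of the two parts of \<open>u\<close>.\<close>

lemma prol_bracket_emb_right:
  assumes u: "u \<in> Prol" and Y: "Y \<in> L"
  shows "prol_bracket L br u (emb Y) = prol_app u Y"
proof (rule ext)
  fix zs
  have "emb (br (u []) Y) + prol_app (prol_nonpos L br u) Y = prol_app u Y"
    using Y linear_diff[OF linear_prol_app, of u "emb (u [])" Y]
    by (simp add: prol_nonpos_def prol_app_emb)
  then show "prol_bracket L br u (emb Y) zs = prol_app u Y zs"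
    by (simp add: prol_bracket.simps[of _ _ _ _ zs] prol_nonpos_emb prol_bracket_zero Prol_nonpos Prol_app u
        split: list.split)
qed

text \<open>Antisymmetry in \<open>L\<close> adjusts the first term. Through this sign the structure
  constants become coordinates of \<open>- prol_app (B j) (X i)\<close>.\<close>

lemma prol_bracket_emb_left:
  assumes u: "u \<in> Prol" and X: "X \<in> L"
  shows "prol_bracket L br (emb X) u = - prol_app u X"
proof (rule ext)
  fix zs
  have "emb (br X (u [])) - prol_app (prol_nonpos L br u) X = - prol_app u X"
    using X Prol_Nil[OF u] br_antisym[of X "u []"] linear_diff[OF linear_prol_app, of u "emb (u [])" X]
    by (simp add: prol_nonpos_def prol_app_emb emb_minus br_closed)
  then show "prol_bracket L br (emb X) u zs = (- prol_app u X) zs"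
    by (simp add: prol_bracket.simps[of _ _ _ _ zs] prol_nonpos_emb prol_bracket_zero Prol_nonpos Prol_app u
        split: list.split)
qed

text \<open>Iterates \<open>[[u, X], Y] = [[u, Y], X] + [u, [X, Y]]\<close>: each \<open>X\<close>
  either passes \<open>Y\<close> or is absorbed in it, and the binomial coefficient counts the
  choices. The induction peels off the innermost bracket and ends with Pascal's rule.\<close>

lemma funpow_app_commute:
  assumes "X \<in> L" "Y \<in> L" "u \<in> Prol"
  shows "prol_app (((\<lambda>w. prol_app w X) ^^ k) u) Y =
    (\<Sum>j\<le>k. real (k choose j) *\<^sub>R ((\<lambda>w. prol_app w X) ^^ (k - j)) (prol_app u ((br X ^^ j) Y)))"
  using assms(3)
proof (induction k arbitrary: u)
  case (Suc k)
  let ?R = "\<lambda>w. prol_app w X"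
  define g where "g i j = (?R ^^ i) (prol_app u ((br X ^^ j) Y))" for i j
  have "prol_app ((?R ^^ Suc k) u) Y = prol_app ((?R ^^ k) (?R u)) Y"
    by (simp only: funpow_Suc_right o_apply)
  also have "\<dots> = (\<Sum>j\<le>k. real (k choose j) *\<^sub>R (?R ^^ (k - j)) (prol_app (?R u) ((br X ^^ j) Y)))"
    using Suc Prol_app by blast
  also have "\<dots> = (\<Sum>j\<le>k. real (k choose j) *\<^sub>R (g (Suc k - j) j + g (k - j) (Suc j)))"
  proof (intro sum.cong refl)
    fix j assume "j \<in> {..k}"
    then have j: "Suc k - j = Suc (k - j)" by (simp add: Suc_diff_le)
    have "prol_app (?R u) ((br X ^^ j) Y) = ?R (prol_app u ((br X ^^ j) Y)) + prol_app u ((br X ^^ Suc j) Y)"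
      using Prol_app_br[OF Suc.prems assms(1) funpow_br_closed[OF assms(1,2), of j]] by simp
    then show "real (k choose j) *\<^sub>R (?R ^^ (k - j)) (prol_app (?R u) ((br X ^^ j) Y))
        = real (k choose j) *\<^sub>R (g (Suc k - j) j + g (k - j) (Suc j))"
      unfolding g_def j
      by (simp add: linear_add[OF linear_funpow[OF linear_prol_app]] funpow_Suc_right del: funpow.simps)
  qed
  also have "\<dots> = (\<Sum>j\<le>k. real (k choose j) *\<^sub>R g (Suc k - j) j) + (\<Sum>j\<le>k. real (k choose j) *\<^sub>R g (k - j) (Suc j))"
    by (simp add: scaleR_add_right sum.distrib)
  also have "(\<Sum>j\<le>k. real (k choose j) *\<^sub>R g (Suc k - j) j) = (\<Sum>j\<le>Suc k. real (k choose j) *\<^sub>R g (Suc k - j) j)"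
    by simp
  also have "\<dots> = g (Suc k) 0 + (\<Sum>j\<le>k. real (k choose Suc j) *\<^sub>R g (k - j) (Suc j))"
    by (subst sum.atMost_Suc_shift) simp
  also have "\<dots> + (\<Sum>j\<le>k. real (k choose j) *\<^sub>R g (k - j) (Suc j))
      = g (Suc k) 0 + (\<Sum>j\<le>k. real (Suc k choose Suc j) *\<^sub>R g (k - j) (Suc j))"
    by (simp add: scaleR_add_left sum.distrib add.assoc add.commute)
  also have "\<dots> = (\<Sum>j\<le>Suc k. real (Suc k choose j) *\<^sub>R g (Suc k - j) j)"
    by (subst sum.atMost_Suc_shift) simp
  finally show ?case unfolding g_def .
qed simp

text \<open>Expanded by \<open>Prol_app_br\<close>, one application to \<open>(br X ^^ j) Y\<close>
  is a combination of \<open>j + 1\<close> successive brackets, so it uses up \<open>Suc j\<close>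
  of the bound.\<close>

lemma vanishing_app_funpow_br:
  assumes "X \<in> L" "Y \<in> L" "u \<in> Prol" "vanishing m u"
  shows "vanishing (m - Suc j) (prol_app u ((br X ^^ j) Y))"
  using assms(3,4)
proof (induction j arbitrary: u m)
  case 0
  then show ?case using vanishing_prol_app by force
next
  case (Suc j)
  have 1: "vanishing (m - 1 - Suc j) (prol_app (prol_app u X) ((br X ^^ j) Y))"
    using Suc by (intro Suc.IH Prol_app vanishing_prol_app)
  have 2: "vanishing (m - Suc j - 1) (prol_app (prol_app u ((br X ^^ j) Y)) X)"
    using Suc by (intro Suc.IH vanishing_prol_app)
  show ?case
    using 1 2 Prol_app_br[OF Suc.prems(1) assms(1) funpow_br_closed[OF assms(1,2), of j]]
    by (simp add: vanishing_def)
qed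

text \<open>The operator identity \<open>e\<^sup>A B = (e\<^sup>A B e\<^sup>-\<^sup>A) e\<^sup>A\<close>, where conjugation by an exponential is the
  exponential of the adjoint action.\<close>

lemma exp_app_commute:
  assumes X: "X \<in> L" and Y: "Y \<in> L" and u: "u \<in> Prol" and N: "vanishing N u"
  shows "prol_app (exp_app N X t u) Y = exp_app N X t (prol_app u (exp_ad br N X t Y))"
proof -
  let ?R = "\<lambda>w. prol_app w X"
  let ?c = "\<lambda>k. (- t) ^ k / fact k"
  define g where "g j i = (?c i * ?c j) *\<^sub>R (?R ^^ i) (prol_app u ((br X ^^ j) Y))" for i j
  note linR = linear_funpow[OF linear_prol_app]
  have coef: "?c k * real (k choose j) = ?c (k - j) * ?c j" if "j \<le> k" for j k
    using that by (simp add: binomial_fact power_add[symmetric])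
  \<comment> \<open>Such a term is an iterated bracket of depth \<open>j + 1 + i\<close>. Its
    vanishing allows the triangle \<open>j + i < N\<close> to be enlarged to a square, so that the
    truncated series multiply exactly.\<close>
  have g0: "g j i = 0" if "\<not> j + i < N" for i j
  proof -
    have "vanishing (N - Suc j - i) ((?R ^^ i) (prol_app u ((br X ^^ j) Y)))"
      by (intro vanishing_funpow vanishing_app_funpow_br X Y u N)
    moreover have "N - Suc j - i = 0" using that by simp
    ultimately show ?thesis by (simp add: g_def vanishing_0)
  qed
  have "prol_app (exp_app N X t u) Y = (\<Sum>k<N. ?c k *\<^sub>R prol_app ((?R ^^ k) u) Y)"
    by (simp add: exp_app_def linear_sum[OF linear_prol_app] linear_scale[OF linear_prol_app])
  also have "\<dots> = (\<Sum>k<N. \<Sum>j\<le>k. g j (k - j))"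
    by (intro sum.cong refl, simp only: funpow_app_commute[OF X Y u] scaleR_sum_right scaleR_scaleR g_def)
      (intro sum.cong refl, simp only: coef atMost_iff)
  also have "\<dots> = (\<Sum>(j, i)\<in>{(j, i). j + i < N}. g j i)"
    by (rule sum.triangle_reindex[symmetric])
  also have "\<dots> = (\<Sum>(j, i)\<in>{..<N} \<times> {..<N}. g j i)"
    by (rule sum.mono_neutral_left) (auto simp: g0)
  also have "\<dots> = (\<Sum>i<N. \<Sum>j<N. g j i)"
    by (subst sum.swap) (simp add: sum.cartesian_product)
  also have "\<dots> = exp_app N X t (prol_app u (exp_ad br N X t Y))"
    unfolding exp_app_def exp_ad_def
    by (subst Prol_app_sum[OF u funpow_br_closed[OF X Y]])
      (simp add: linear_sum[OF linR] linear_scale[OF linR] scaleR_sum_right g_def)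
  finally show ?thesis .
qed

lemma exp_ad_L: "X \<in> L \<Longrightarrow> Y \<in> L \<Longrightarrow> exp_ad br N X t Y \<in> L"
  unfolding exp_ad_def by (intro subspace_sum subspace_scale subspace_L funpow_br_closed)

lemma foldl_exp_app_closed:
  assumes "u \<in> Prol" "vanishing m u"
  shows "foldl (\<lambda>u k. exp_app N (X k) (\<tau> k) u) u ls \<in> Prol"
    "vanishing m (foldl (\<lambda>u k. exp_app N (X k) (\<tau> k) u) u ls)"
  using assms by (induction ls arbitrary: u) (auto simp: Prol_exp_app vanishing_exp_app)

text \<open>The last operator of the fold is the outermost and is passed first, so \<open>Y\<close>
  is transformed along \<open>rev ls\<close>, as in \<open>frame\<close>.\<close>

lemma foldl_exp_app_commute:
  assumes "\<And>k. k \<in> set ls \<Longrightarrow> X k \<in> L" and "Y \<in> L" and u: "u \<in> Prol" "vanishing N u"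
  shows "prol_app (foldl (\<lambda>u k. exp_app N (X k) (\<tau> k) u) u ls) Y =
    foldl (\<lambda>u k. exp_app N (X k) (\<tau> k) u)
      (prol_app u (foldl (\<lambda>Y k. exp_ad br N (X k) (\<tau> k) Y) Y (rev ls))) ls"
  using assms(1,2)
proof (induction ls arbitrary: Y rule: rev_induct)
  case (snoc k ls)
  then have k: "X k \<in> L" by simp
  let ?f = "foldl (\<lambda>u k. exp_app N (X k) (\<tau> k) u) u ls"
  have "prol_app (exp_app N (X k) (\<tau> k) ?f) Y
      = exp_app N (X k) (\<tau> k) (prol_app ?f (exp_ad br N (X k) (\<tau> k) Y))"
    using foldl_exp_app_closed[OF u] snoc.prems k by (intro exp_app_commute) auto
  then show ?case
    using snoc k by (simp add: exp_ad_L)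
qed simp

end

lemma stratified_vf_bracket:
  assumes "stratification (lie_algebra G) vf_bracket S s"
  shows "stratified_lie_algebra (lie_algebra G) vf_bracket S s"
  by standard
    (use assms in \<open>auto intro: vf_bracket_add_left vf_bracket_scale_left vf_bracket_jacobi
      vf_bracket_antisym lie_algebraD(1)\<close>)

section \<open>Extremal polynomials\<close>

text \<open>Multi-indices live on the whole coordinate type and are \<open>0\<close> in directions
  not yet processed. There the factor in the product over \<open>UNIV\<close> is \<open>1\<close>,
  so the coefficients need no restriction to \<open>ls\<close>.\<close>

lemma foldl_exp_app_expand:
  fixes x :: "real^'n::finite" and idx :: "int \<Rightarrow> 'n"
  assumes "distinct (map idx ls)"
  shows "foldl (\<lambda>u l. exp_app N (X l) (x $ idx l) u) u ls =
    (\<Sum>\<alpha> | (\<forall>i\<in>idx ` set ls. \<alpha> i < N) \<and> (\<forall>i. i \<notin> idx ` set ls \<longrightarrow> \<alpha> i = 0).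
      (\<Prod>i\<in>UNIV. (- (x $ i)) ^ \<alpha> i / fact (\<alpha> i)) *\<^sub>R
        foldl (\<lambda>u l. ((\<lambda>w. prol_app w (X l)) ^^ \<alpha> (idx l)) u) u ls)"
  using assms
proof (induction ls rule: rev_induct)
  case Nil
  have "{\<alpha>. (\<forall>i\<in>idx ` set []. \<alpha> i < N) \<and> (\<forall>i. i \<notin> idx ` set [] \<longrightarrow> \<alpha> i = (0::nat))} = {\<lambda>_. 0}"
    by auto
  then show ?case by simp
next
  case (snoc l ls)
  let ?A = "\<lambda>ls. {\<alpha>. (\<forall>i\<in>idx ` set ls. \<alpha> i < N) \<and> (\<forall>i. i \<notin> idx ` set ls \<longrightarrow> \<alpha> i = 0)}"
  let ?c = "\<lambda>\<alpha>. \<Prod>i\<in>UNIV. (- (x $ i)) ^ \<alpha> i / fact (\<alpha> i)"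
  let ?R = "\<lambda>k. (\<lambda>w. prol_app w (X l)) ^^ k"
  let ?w = "\<lambda>\<alpha>. foldl (\<lambda>u l. ((\<lambda>w. prol_app w (X l)) ^^ \<alpha> (idx l)) u) u ls"
  have l: "idx l \<notin> idx ` set ls" and d: "distinct (map idx ls)"
    using snoc.prems by auto
  have w: "?w (\<alpha>(idx l := k)) = ?w \<alpha>" for \<alpha> k
    by (rule foldl_cong) (use l in \<open>auto simp: image_iff\<close>)
  have c: "?c (\<alpha>(idx l := k)) = ((- (x $ idx l)) ^ k / fact k) * ?c \<alpha>" if "\<alpha> (idx l) = 0" for \<alpha> k
    by (subst (1 2) prod.remove[of UNIV "idx l"]) (auto simp: that intro!: prod.cong)
  have "foldl (\<lambda>u l. exp_app N (X l) (x $ idx l) u) u (ls @ [l])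
      = exp_app N (X l) (x $ idx l) (\<Sum>\<alpha>\<in>?A ls. ?c \<alpha> *\<^sub>R ?w \<alpha>)"
    using snoc.IH[OF d] by simp
  also have "\<dots> = (\<Sum>k<N. \<Sum>\<alpha>\<in>?A ls. (((- (x $ idx l)) ^ k / fact k) * ?c \<alpha>) *\<^sub>R ?R k (?w \<alpha>))"
    by (simp only: exp_app_def linear_sum[OF linear_funpow[OF linear_prol_app]]
        linear_scale[OF linear_funpow[OF linear_prol_app]] scaleR_sum_right scaleR_scaleR)
  also have "\<dots> = (\<Sum>(k, \<alpha>)\<in>{..<N} \<times> ?A ls. (((- (x $ idx l)) ^ k / fact k) * ?c \<alpha>) *\<^sub>R ?R k (?w \<alpha>))"
    by (rule sum.cartesian_product)
  also have "\<dots> = (\<Sum>\<alpha>\<in>?A (ls @ [l]). ?c \<alpha> *\<^sub>R ?R (\<alpha> (idx l)) (?w \<alpha>))"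
  \<comment> \<open>The new exponent \<open>k\<close> is stored at \<open>idx l\<close>. The
    direction is new, so \<open>\<alpha>\<close> is \<open>0\<close> there and the pair can be
    recovered.\<close>
  proof (rule sum.reindex_bij_witness[where j="\<lambda>(k, \<alpha>). \<alpha>(idx l := k)" and i="\<lambda>\<alpha>. (\<alpha> (idx l), \<alpha>(idx l := 0))"])
    fix p assume p: "p \<in> {..<N} \<times> ?A ls"
    obtain k \<alpha> where k\<alpha>: "p = (k, \<alpha>)" by (cases p)
    have 0: "\<alpha> (idx l) = 0" using p l k\<alpha> by auto
    then show "(\<lambda>\<alpha>. (\<alpha> (idx l), \<alpha>(idx l := 0))) (case p of (k, \<alpha>) \<Rightarrow> \<alpha>(idx l := k)) = p"
      using k\<alpha> by auto
    show "(case p of (k, \<alpha>) \<Rightarrow> \<alpha>(idx l := k)) \<in> ?A (ls @ [l])"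
      using p k\<alpha> by auto
    show "?c (case p of (k, \<alpha>) \<Rightarrow> \<alpha>(idx l := k)) *\<^sub>R
        ?R ((case p of (k, \<alpha>) \<Rightarrow> \<alpha>(idx l := k)) (idx l)) (?w (case p of (k, \<alpha>) \<Rightarrow> \<alpha>(idx l := k)))
      = (case p of (k, \<alpha>) \<Rightarrow> (((- (x $ idx l)) ^ k / fact k) * ?c \<alpha>) *\<^sub>R ?R k (?w \<alpha>))"
      unfolding k\<alpha> prod.case w c[of \<alpha>, OF 0] by simp
  qed (use l in auto)
  finally show ?case by simp
qed

lemma vanishing_foldl_funpow:
  "vanishing m u \<Longrightarrow> vanishing (m - (\<Sum>l\<leftarrow>ls. \<beta> l)) (foldl (\<lambda>u l. ((\<lambda>w. prol_app w (X l)) ^^ \<beta> l) u) u ls)"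
proof (induction ls arbitrary: u m)
  case (Cons l ls)
  from Cons.IH[OF vanishing_funpow[OF Cons.prems]] show ?case by simp
qed simp

text \<open>Linearity is asked on \<open>Prol\<close> because \<open>representation\<close> is zero
  outside the span of the basis. \<open>lam\<close> stays abstract since the locale is interpreted
  for the form given by \<open>v\<close> and again for an arbitrary linear form.\<close>

locale extremal_polynomials = stratified_lie_algebra L br S s
  for L :: "'v::real_vector set" and br S s +
  fixes idx :: "int \<Rightarrow> 'n::finite" and X :: "int \<Rightarrow> 'v" and lam :: "'v prol \<Rightarrow> real"
  assumes idx: "bij_betw idx {1..int CARD('n)} UNIV"
    and X_L: "\<And>l. l \<in> {1..int CARD('n)} \<Longrightarrow> X l \<in> L"
    and lam_add: "\<And>u w. u \<in> Prol \<Longrightarrow> w \<in> Prol \<Longrightarrow> lam (u + w) = lam u + lam w"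
    and lam_scale: "\<And>c u. u \<in> Prol \<Longrightarrow> lam (c *\<^sub>R u) = c * lam u"
begin

lemma lam_0: "lam 0 = 0"
  using lam_scale[of 0 0] subspace_0[OF subspace_Prol] by simp

lemma lam_sum:
  "(\<And>a. a \<in> A \<Longrightarrow> w a \<in> Prol) \<Longrightarrow> lam (\<Sum>a\<in>A. c a *\<^sub>R w a) = (\<Sum>a\<in>A. c a * lam (w a))"
proof (induction A rule: infinite_finite_induct)
  case (insert a A)
  then have "(\<Sum>a\<in>A. c a *\<^sub>R w a) \<in> Prol"
    by (intro subspace_sum subspace_scale subspace_Prol) auto
  then show ?case
    using insert by (simp add: lam_add lam_scale Prol_closed del: plus_fun_apply)
qed (simp_all add: lam_0)

definition iter :: "'v prol \<Rightarrow> ('n \<Rightarrow> nat) \<Rightarrow> 'v prol"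
  where "iter u \<alpha> = foldl (\<lambda>u l. ((\<lambda>w. prol_app w (X l)) ^^ \<alpha> (idx l)) u) u [1..int CARD('n)]"

text \<open>The extremal polynomial of an arbitrary element of the prolongation, linear in that element.\<close>

definition EP :: "'v prol \<Rightarrow> real^'n \<Rightarrow> real"
  where "EP u x = Sum_any (\<lambda>\<alpha>. (- 1) ^ (\<Sum>l\<in>UNIV. \<alpha> l) / (\<Prod>l\<in>UNIV. fact (\<alpha> l))
       * lam (iter u \<alpha>) * (\<Prod>l\<in>UNIV. (x $ l) ^ \<alpha> l))"

text \<open>The list argument allows the product to be cut at one index, separating the factor to be
  differentiated from those applied before and after it.\<close>

definition exps :: "nat \<Rightarrow> real^'n \<Rightarrow> int list \<Rightarrow> 'v prol \<Rightarrow> 'v prol"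
  where "exps N x ls u = foldl (\<lambda>u l. exp_app N (X l) (x $ idx l) u) u ls"

lemma linear_exps: "linear (exps N x ls)"
  unfolding exps_def by (intro linear_foldl linear_exp_app)

lemma exps_closed:
  assumes "u \<in> Prol" "vanishing m u"
  shows "exps N x ls u \<in> Prol" "vanishing m (exps N x ls u)"
  unfolding exps_def by (rule foldl_exp_app_closed[OF assms])+

lemma exps_Prol: "u \<in> Prol \<Longrightarrow> exps N x ls u \<in> Prol"
  using exps_closed Prol_vanishing by blast

lemma distinct_idx: "distinct (map idx [1..int CARD('n)])"
  and idx_range: "idx ` set [1..int CARD('n)] = UNIV"
  using idx by (auto simp: bij_betw_def distinct_map)

lemma iter_Prol: "u \<in> Prol \<Longrightarrow> iter u \<alpha> \<in> Prol"
proof -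
  have "u \<in> Prol \<Longrightarrow> foldl (\<lambda>u l. ((\<lambda>w. prol_app w (X l)) ^^ \<alpha> (idx l)) u) u ls \<in> Prol" for ls
    by (induction ls arbitrary: u) (simp_all add: Prol_funpow)
  then show "u \<in> Prol \<Longrightarrow> iter u \<alpha> \<in> Prol" by (simp add: iter_def)
qed

lemma iter_eq_0:
  assumes "vanishing N u" "N \<le> \<alpha> i"
  shows "iter u \<alpha> = 0"
proof -
  have "i \<in> idx ` {1..int CARD('n)}" using idx by (auto simp: bij_betw_def)
  then obtain l where l: "l \<in> set [1..int CARD('n)]" "i = idx l" by auto
  then have "\<alpha> i \<le> (\<Sum>l\<leftarrow>[1..int CARD('n)]. \<alpha> (idx l))"
    by (intro member_le_sum_list) auto
  then show ?thesis
    using vanishing_foldl_funpow[OF assms(1), of "\<lambda>l. \<alpha> (idx l)" "[1..int CARD('n)]" X] assms(2)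
    by (simp add: iter_def vanishing_0)
qed

lemma finite_multi_indices: "finite {\<alpha> :: 'n \<Rightarrow> nat. \<forall>i. \<alpha> i < N}"
proof -
  have "{\<alpha> :: 'n \<Rightarrow> nat. \<forall>i. \<alpha> i < N} = (\<Pi>\<^sub>E i\<in>UNIV. {..<N})"
    by (auto simp: PiE_def)
  then show ?thesis by (simp add: finite_PiE)
qed

lemma EP_eq_sum:
  assumes "vanishing N u"
  shows "EP u x = (\<Sum>\<alpha> | \<forall>i. \<alpha> i < N. (- 1) ^ (\<Sum>l\<in>UNIV. \<alpha> l) / (\<Prod>l\<in>UNIV. fact (\<alpha> l))
       * lam (iter u \<alpha>) * (\<Prod>l\<in>UNIV. (x $ l) ^ \<alpha> l))"
  unfolding EP_def
proof (rule Sum_any.expand_superset[OF finite_multi_indices], safe)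
  fix \<alpha> i
  assume *: "(- 1) ^ (\<Sum>l\<in>UNIV. \<alpha> l) / (\<Prod>l\<in>UNIV. fact (\<alpha> l))
       * lam (iter u \<alpha>) * (\<Prod>l\<in>UNIV. (x $ l) ^ \<alpha> l) \<noteq> 0"
  show "\<alpha> i < N"
  proof (rule ccontr)
    assume "\<not> \<alpha> i < N"
    then have "iter u \<alpha> = 0" using iter_eq_0[OF assms, of \<alpha> i] by simp
    with * show False by (simp add: lam_0)
  qed
qed

text \<open>Any \<open>N\<close> that annihilates \<open>u\<close> is admissible, so elements with
  different bounds can be compared at a common order.\<close>

lemma EP_eq_exps:
  assumes u: "u \<in> Prol" and N: "vanishing N u"
  shows "EP u x = lam (exps N x [1..int CARD('n)] u)"
proof -
  have coef: "(\<Prod>i\<in>UNIV. (- (x $ i)) ^ \<alpha> i / fact (\<alpha> i))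
      = (- 1) ^ (\<Sum>l\<in>UNIV. \<alpha> l) / (\<Prod>l\<in>UNIV. fact (\<alpha> l)) * (\<Prod>l\<in>UNIV. (x $ l) ^ \<alpha> l)" for \<alpha> :: "'n \<Rightarrow> nat"
    by (simp add: prod_dividef power_minus[of "x $ _"] prod.distrib power_sum)
  have "exps N x [1..int CARD('n)] u
      = (\<Sum>\<alpha> | \<forall>i. \<alpha> i < N. (\<Prod>i\<in>UNIV. (- (x $ i)) ^ \<alpha> i / fact (\<alpha> i)) *\<^sub>R iter u \<alpha>)"
    unfolding exps_def iter_def foldl_exp_app_expand[OF distinct_idx] idx_range by simp
  then show ?thesis
    by (simp add: lam_sum iter_Prol u EP_eq_sum[OF N] coef mult_ac)
qed

lemma EP_add: "u \<in> Prol \<Longrightarrow> w \<in> Prol \<Longrightarrow> EP (u + w) x = EP u x + EP w x"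
proof -
  assume u: "u \<in> Prol" and w: "w \<in> Prol"
  obtain m m' where "vanishing m u" "vanishing m' w" using Prol_vanishing u w by blast
  then have v: "vanishing (max m m') u" "vanishing (max m m') w" "vanishing (max m m') (u + w)"
    by (auto simp: vanishing_def)
  show ?thesis
    using u w v Prol_closed(2)[OF u w]
    by (simp only: EP_eq_exps linear_add[OF linear_exps] lam_add exps_Prol)
qed

lemma EP_scale: "u \<in> Prol \<Longrightarrow> EP (c *\<^sub>R u) x = c * EP u x"
proof -
  assume u: "u \<in> Prol"
  obtain m where "vanishing m u" using Prol_vanishing u by blast
  then have v: "vanishing m u" "vanishing m (c *\<^sub>R u)"
    by (auto simp: vanishing_def scaleR_fun_def)
  show ?thesis
    using u v Prol_closed(4)[OF u]
    by (simp only: EP_eq_exps linear_scale[OF linear_exps] lam_scale exps_Prol)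
qed

lemma EP_minus: "u \<in> Prol \<Longrightarrow> EP (- u) x = - EP u x"
  using EP_scale[of u "- 1" x] by simp

lemma EP_zero: "EP 0 x = 0"
  using EP_scale[of 0 0 x] subspace_0[OF subspace_Prol] by simp

lemma EP_sum:
  "(\<And>a. a \<in> A \<Longrightarrow> w a \<in> Prol) \<Longrightarrow> EP (\<Sum>a\<in>A. c a *\<^sub>R w a) x = (\<Sum>a\<in>A. c a * EP (w a) x)"
proof (induction A rule: infinite_finite_induct)
  case (insert a A)
  then have "(\<Sum>a\<in>A. c a *\<^sub>R w a) \<in> Prol"
    by (intro subspace_sum subspace_scale subspace_Prol) auto
  then show ?case
    using insert by (simp add: EP_add EP_scale Prol_closed del: plus_fun_apply)
qed (simp_all add: EP_zero)

lemma EP_at_0: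
  assumes u: "u \<in> Prol"
  shows "EP u 0 = lam u"
proof -
  obtain m where m: "vanishing m u" using Prol_vanishing u by blast
  \<comment> \<open>At order \<open>Suc m\<close> the truncated series contains its term
    \<open>k = 0\<close>; at order \<open>0\<close> it would be empty, and not the identity.\<close>
  then have v: "vanishing (Suc m) u" by (rule vanishing_mono) simp
  have "exp_app (Suc m) Y 0 w = w" for Y :: 'v and w
    unfolding exp_app_def by (subst sum.lessThan_Suc_shift) simp
  then have "exps (Suc m) 0 ls u = u" for ls
    unfolding exps_def by (induction ls) simp_all
  then show ?thesis by (simp add: EP_eq_exps[OF u v])
qed

lemma real_polynomial_function_EP: "u \<in> Prol \<Longrightarrow> real_polynomial_function (EP u)"
proof -
  assume "u \<in> Prol"
  then obtain N where N: "vanishing N u" using Prol_vanishing by blast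
  have "real_polynomial_function (\<lambda>x::real^'n. x $ l)" for l
    by (intro real_polynomial_function.intros(1) bounded_linear_vec_nth)
  then show ?thesis
    unfolding EP_eq_sum[OF N, abs_def]
    by (intro real_polynomial_function_sum real_polynomial_function.intros(2,4)
        real_polynomial_function_prod real_polynomial_function_power finite_multi_indices) auto
qed

text \<open>The minus sign turns \<open>prol_app u\<close>, a bracket on the right, into the bracket
  on the left. The fold is written exactly as in \<open>frame\<close>, so that the group computation
  can be inserted by unfolding.\<close>

lemma EP_axis_derivative:
  assumes u: "u \<in> Prol" and N: "vanishing N u" and l: "l \<in> {1..int CARD('n)}"
  shows "fd (EP u) x (axis (idx l) 1) =
    - EP (prol_app u (foldl (\<lambda>Y k. exp_ad br N (X k) (x $ idx k) Y) (X l) (rev [1..l-1]))) x"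
proof -
  define Y where "Y = foldl (\<lambda>Y k. exp_ad br N (X k) (x $ idx k) Y) (X l) (rev [1..l-1])"
  define w where "w = exps N x [1..l-1] u"
  define H where "H z = lam (exps N x [l+1..int CARD('n)] z)" for z
  define y where "y t = (x - (x $ idx l) *\<^sub>R axis (idx l) 1) + t *\<^sub>R axis (idx l) 1" for t
  define a where "a k t = (- t) ^ k / fact k" for k and t :: real
  let ?t = "x $ idx l"
  let ?R = "\<lambda>w. prol_app w (X l)"
  have wP: "w \<in> Prol" "vanishing N w" using exps_closed[OF u N] by (simp_all add: w_def)
  have split: "[1..int CARD('n)] = [1..l-1] @ l # [l+1..int CARD('n)]"
  proof -
    have "[1..int CARD('n)] = [1..l-1] @ [l..int CARD('n)]"
      using l by (intro upto_split1) auto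
    also have "[l..int CARD('n)] = l # [l+1..int CARD('n)]"
      using l by (intro upto_rec1) auto
    finally show ?thesis .
  qed
  have exps_split: "exps N z [1..int CARD('n)] q
    = exps N z [l+1..int CARD('n)] (exp_app N (X l) (z $ idx l) (exps N z [1..l-1] q))" for z q
    by (simp add: exps_def split)
  have coords: "y t $ idx k = (if k = l then t else x $ idx k)" if "k \<in> {1..int CARD('n)}" for k t
    using idx that l by (auto simp: y_def axis_def bij_betw_def inj_on_def)
  have H_sum: "H (\<Sum>k<N. c k *\<^sub>R z k) = (\<Sum>k<N. c k * H (z k))" if "\<And>k. z k \<in> Prol" for c z
    using that
    by (simp add: H_def linear_sum[OF linear_exps] linear_scale[OF linear_exps] lam_sum exps_Prol)
  have EP_y: "EP u (y t) = (\<Sum>k<N. a k t * H ((?R ^^ k) w))" for t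
  proof -
    have 1: "exps N (y t) [1..l-1] u = w"
      unfolding w_def exps_def by (rule foldl_cong) (use l coords in auto)
    have 2: "exps N (y t) [l+1..int CARD('n)] z = exps N x [l+1..int CARD('n)] z" for z
      unfolding exps_def by (rule foldl_cong) (use l coords in auto)
    have "EP u (y t) = H (exp_app N (X l) t w)"
      using coords[OF l] by (simp add: EP_eq_exps[OF u N] exps_split 1 2 H_def)
    then show ?thesis
      by (simp add: exp_app_def H_sum Prol_funpow wP a_def)
  qed
  define b where "b k = - (if k = 0 then 0 else a (k - 1) ?t) * H ((?R ^^ k) w)" for k
  have "((\<lambda>t. EP u (y t)) has_real_derivative (\<Sum>k<N. b k)) (at ?t)"
    unfolding EP_y b_def a_def
    by (intro DERIV_sum DERIV_cmult_right exp_coefficient_derivative)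
  moreover have "((\<lambda>t. EP u (y t)) has_vector_derivative fd (EP u) (y ?t) (axis (idx l) 1)) (at ?t)"
    unfolding y_def
    by (intro fd_along_line differentiable_at_real_polynomial_function real_polynomial_function_EP u)
  moreover have "y ?t = x" by (simp add: y_def)
  ultimately have "fd (EP u) x (axis (idx l) 1) = (\<Sum>k<N. b k)"
    using vector_derivative_unique_at by (metis has_real_derivative_iff_has_vector_derivative)
  \<comment> \<open>The added term is zero. With it, dropping \<open>b 0 = 0\<close> and shifting
    the index leaves exactly \<open>N\<close> terms, again a full truncated exponential.\<close>
  also have "\<dots> = (\<Sum>k<Suc N. b k)"
  proof -
    have "(?R ^^ N) w = 0"
      using vanishing_funpow[OF wP(2), of N "X l"] by (simp add: vanishing_0)
    then have "b N = 0"
      using linear_0[OF linear_exps] by (simp add: b_def H_def lam_0)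
    then show ?thesis by simp
  qed
  also have "\<dots> = (\<Sum>k<N. - a k ?t * H ((?R ^^ Suc k) w))"
    by (subst sum.lessThan_Suc_shift) (simp add: b_def)
  also have "\<dots> = - (\<Sum>k<N. a k ?t * H ((?R ^^ k) (?R w)))"
    by (simp only: funpow_Suc_right o_apply sum_negf mult_minus_left)
  also have "\<dots> = - H (exp_app N (X l) ?t (?R w))"
    by (simp add: exp_app_def H_sum Prol_funpow Prol_app wP a_def)
  also have "?R w = exps N x [1..l-1] (prol_app u Y)"
    unfolding w_def exps_def Y_def
    by (rule foldl_exp_app_commute) (use l X_L u N in auto)
  also have "- H (exp_app N (X l) ?t (exps N x [1..l-1] (prol_app u Y))) = - EP (prol_app u Y) x"
  proof -
    have "vanishing N (prol_app u Y)"
      using vanishing_prol_app[OF N] by (rule vanishing_mono) simp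
    then show ?thesis
      using Prol_app[OF u] by (simp add: EP_eq_exps exps_split H_def)
  qed
  finally show ?thesis by (simp add: Y_def)
qed

end

section \<open>Linear forms given by coordinates in a basis\<close>

definition coord_form :: "(int \<Rightarrow> 'v::real_vector) \<Rightarrow> int set \<Rightarrow> (int \<Rightarrow> real) \<Rightarrow> 'v \<Rightarrow> real"
  where "coord_form B J g u = Sum_any (\<lambda>k. coord B J u k * g k)"

context
  fixes B :: "int \<Rightarrow> 'v::real_vector" and J :: "int set"
  assumes inj: "inj_on B J" and indep: "independent (B ` J)"
begin

lemma finite_coord: "finite {k. coord B J u k \<noteq> 0}"
proof (rule finite_imageD)
  have "B ` {k. coord B J u k \<noteq> 0} \<subseteq> {b. representation (B ` J) u b \<noteq> 0}"
    by (auto simp: coord_def split: if_splits)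
  then show "finite (B ` {k. coord B J u k \<noteq> 0})"
    using real_vector.finite_representation finite_subset by blast
  show "inj_on B {k. coord B J u k \<noteq> 0}"
    by (rule inj_on_subset[OF inj]) (auto simp: coord_def split: if_splits)
qed

lemma coord_form_eq_sum:
  "finite K \<Longrightarrow> {k. coord B J u k \<noteq> 0} \<subseteq> K \<Longrightarrow> coord_form B J g u = (\<Sum>k\<in>K. coord B J u k * g k)"
  unfolding coord_form_def by (rule Sum_any.expand_superset) auto

lemma coord_form_add:
  assumes "u \<in> span (B ` J)" "w \<in> span (B ` J)"
  shows "coord_form B J g (u + w) = coord_form B J g u + coord_form B J g w"
proof -
  let ?K = "{k. coord B J u k \<noteq> 0} \<union> {k. coord B J w k \<noteq> 0}"
  have add: "coord B J (u + w) k = coord B J u k + coord B J w k" for k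
    using real_vector.representation_add[OF indep assms(2) assms(1)] by (simp add: coord_def)
  have "finite ?K" by (simp add: finite_coord)
  then show ?thesis
    by (subst (1 2 3) coord_form_eq_sum[of ?K]) (auto simp: add sum.distrib distrib_right)
qed

lemma coord_form_scale:
  assumes "u \<in> span (B ` J)"
  shows "coord_form B J g (c *\<^sub>R u) = c * coord_form B J g u"
proof -
  let ?K = "{k. coord B J u k \<noteq> 0}"
  have scale: "coord B J (c *\<^sub>R u) k = c * coord B J u k" for k
    using real_vector.representation_scale[OF indep assms] by (simp add: coord_def)
  show ?thesis
    by (subst (1 2) coord_form_eq_sum[of ?K]) (auto simp: finite_coord scale sum_distrib_left mult.assoc)
qed

lemma coord_form_basis:
  assumes "j \<in> J"
  shows "coord_form B J g (B j) = g j"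
proof -
  have c: "coord B J (B j) k = (if k = j then 1 else 0)" for k
    using assms inj by (auto simp: coord_def real_vector.representation_basis[OF indep] inj_on_def)
  show ?thesis
    by (subst coord_form_eq_sum[of "{j}"]) (auto simp: c)
qed

lemma sum_coord:
  assumes "u \<in> span (B ` J)"
  shows "(\<Sum>k | coord B J u k \<noteq> 0. coord B J u k *\<^sub>R B k) = u"
proof -
  have "(\<Sum>b | representation (B ` J) u b \<noteq> 0. representation (B ` J) u b *\<^sub>R b) = u"
    using real_vector.sum_nonzero_representation_eq[OF indep assms] .
  moreover have "{b. representation (B ` J) u b \<noteq> 0} = B ` {k. coord B J u k \<noteq> 0}"
    using real_vector.representation_ne_zero by (fastforce simp: coord_def split: if_splits)
  moreover have "inj_on B {k. coord B J u k \<noteq> 0}"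
    by (rule inj_on_subset[OF inj]) (auto simp: coord_def split: if_splits)
  moreover have "coord B J u k = representation (B ` J) u (B k)" if "coord B J u k \<noteq> 0" for k
    using that by (simp add: coord_def split: if_splits)
  ultimately show ?thesis by (simp add: sum.reindex)
qed

end

text \<open>Directness of the strata shows that the basis elements of degree one span
  \<open>S 1\<close>, so their number is its dimension; since degrees do not decrease along the
  basis, they are the first ones.\<close>

lemma (in stratified_lie_algebra) adapted_basis_first_stratum:
  assumes "adapted_basis {1..s} S {1..n} X"
  shows "S 1 \<subseteq> span (X ` {1..int (dim (S 1))})"
    and "\<And>i. i \<in> {1..int (dim (S 1))} \<Longrightarrow> X i \<in> S 1 \<and> i \<le> n"
proof -
  obtain d where inj: "inj_on X {1..n}" and indep: "independent (X ` {1..n})"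
    and span: "span (X ` {1..n}) = L"
    and "\<forall>j\<in>{1..n}. d j \<in> {1..s} \<and> X j \<in> S (d j)"
    and "\<forall>i\<in>{1..n}. \<forall>j\<in>{1..n}. i < j \<longrightarrow> d i \<le> d j"
    using assms unfolding adapted_basis_def span_S by blast
  then have d: "j \<in> {1..n} \<Longrightarrow> d j \<in> {1..s} \<and> X j \<in> S (d j)"
    and mono: "i \<in> {1..n} \<Longrightarrow> j \<in> {1..n} \<Longrightarrow> i < j \<Longrightarrow> d i \<le> d j" for i j
    by blast+
  define D where "D = {j \<in> {1..n}. d j = 1}"
  have S1: "S 1 \<subseteq> span (X ` D)"
  proof
    fix W assume W: "W \<in> S 1"
    define K where "K = {k. coord X {1..n} W k \<noteq> 0}"
    let ?a = "coord X {1..n} W"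
    have "W \<in> span (X ` {1..n})" using W S_subset_L span by auto
    then have eq: "(\<Sum>k\<in>K. ?a k *\<^sub>R X k) = W" and K: "finite K" "K \<subseteq> {1..n}"
      using sum_coord[OF inj indep] finite_coord[OF inj indep]
      by (auto simp: K_def coord_def split: if_splits)
    \<comment> \<open>The homogeneous components of the expansion of \<open>W\<close>, with
      \<open>W\<close> subtracted in degree one: they add up to zero, so directness applies.\<close>
    define x where "x i = (\<Sum>k | k \<in> K \<and> d k = i. ?a k *\<^sub>R X k) - (if i = 1 then W else 0)" for i
    have xS: "x i \<in> S i" if "i \<in> {1..s}" for i
      unfolding x_def using that K d W
      by (intro subspace_diff subspace_sum subspace_scale subspace_S) (auto intro: subspace_0 subspace_S)
    have x0: "(\<Sum>i=1..s. x i) = 0"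
    proof -
      have "(\<Sum>i=1..s. \<Sum>k | k \<in> K \<and> d k = i. ?a k *\<^sub>R X k) = W"
      proof -
        have "d ` K \<subseteq> {1..s}" using K(2) d by blast
        from sum.group[OF K(1) _ this, of "\<lambda>k. ?a k *\<^sub>R X k"] show ?thesis
          by (simp only: eq finite_atLeastAtMost_int)
      qed
      moreover have "(\<Sum>i=1..s. if i = 1 then W else 0) = W"
        using s_ge_1 by simp
      ultimately show ?thesis by (simp only: x_def sum_subtractf diff_self)
    qed
    have "\<forall>i\<in>{1..s}. x i = 0"
      by (rule S_direct[OF _ x0]) (blast intro: xS)
    with s_ge_1 have "x 1 = 0" by simp
    then have "W = (\<Sum>k | k \<in> K \<and> d k = 1. ?a k *\<^sub>R X k)"
      by (simp add: x_def)
    also have "\<dots> \<in> span (X ` D)"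
      using K by (intro span_sum span_scale span_base) (auto simp: D_def)
    finally show "W \<in> span (X ` D)" .
  qed
  have XD: "X j \<in> S 1" if "j \<in> D" for j
    using that d[of j] by (simp add: D_def)
  then have "X ` D \<subseteq> S 1" by blast
  moreover have "independent (X ` D)"
    using indep by (rule real_vector.independent_mono) (auto simp: D_def)
  ultimately have "dim (S 1) = card (X ` D)"
    using S1 by (intro real_vector.basis_card_eq_dim[symmetric])
  also have "\<dots> = card D"
    by (intro card_image inj_on_subset[OF inj]) (auto simp: D_def)
  finally have card: "dim (S 1) = card D" .
  have D: "D = {1..int (card D)}"
  proof (cases "D = {}")
    case False
    have fin: "finite D" by (rule finite_subset[of _ "{1..n}"]) (auto simp: D_def)
    have "i \<in> D" if "i \<in> {1..Max D}" for i
    proof -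
      have M: "Max D \<in> D" using False fin by simp
      then have "d i \<le> 1" using that mono[of i "Max D"] by (cases "i = Max D") (auto simp: D_def)
      then show ?thesis using that M d[of i] by (auto simp: D_def)
    qed
    moreover have "i \<in> {1..Max D}" if "i \<in> D" for i
      using that fin by (auto simp: D_def)
    ultimately have "D = {1..Max D}" by blast
    moreover have "1 \<le> Max D"
      using False fin Max_in[OF fin False] by (auto simp: D_def)
    ultimately have "card D = nat (Max D)"
      using card_atLeastAtMost_int[of 1 "Max D"] by simp
    with \<open>1 \<le> Max D\<close> have "int (card D) = Max D" by simp
    with \<open>D = {1..Max D}\<close> show ?thesis by simp
  qed simp
  show "S 1 \<subseteq> span (X ` {1..int (dim (S 1))})"
    using S1 D by (simp add: card)
  show "X i \<in> S 1 \<and> i \<le> n" if "i \<in> {1..int (dim (S 1))}" for i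
  proof -
    have "i \<in> D" using that D by (simp add: card)
    then show ?thesis using XD by (simp add: D_def)
  qed
qed

section \<open>The prolongation of the Lie algebra of \<open>G\<close>\<close>

locale tanaka_prolongation =
  fixes G :: "(real^'n::finite) monoid"
    and S :: "int \<Rightarrow> (real^'n \<Rightarrow> real^'n) set"
    and s :: int
    and idx :: "int \<Rightarrow> 'n"
    and X :: "int \<Rightarrow> real^'n \<Rightarrow> real^'n"
    and J :: "int set"
    and B :: "int \<Rightarrow> (real^'n \<Rightarrow> real^'n) prol"
    and v :: "real^'n"
  assumes G: "lie_group G"
    and strat: "stratification (lie_algebra G) vf_bracket S s"
    and basis_X: "adapted_basis {1..s} S {1..int CARD('n)} X"
    and bij_idx: "bij_betw idx {1..int CARD('n)} UNIV"
    and coords: "exp_coordinates_second_type G idx X"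
    and J: "{1..int CARD('n)} \<subseteq> J"
    and basis_B: "adapted_basis {..s} (prol_stratum (lie_algebra G) vf_bracket S s) J B"
    and B_emb: "\<forall>j\<in>{1..int CARD('n)}. B j = prol_emb (lie_algebra G) vf_bracket (X j)"
begin

abbreviation "\<gg> \<equiv> lie_algebra G"

sublocale stratified_lie_algebra \<gg> vf_bracket S s
  using strat by (rule stratified_vf_bracket)

lemma inj_B: "inj_on B J" and indep_B: "independent (B ` J)" and span_B: "span (B ` J) = Prol"
  using basis_B by (simp_all add: adapted_basis_def Prol_def)

lemma B_stratum: "j \<in> J \<Longrightarrow> \<exists>k. B j \<in> P k"
  using basis_B unfolding adapted_basis_def by blast

lemma B_Prol: "j \<in> J \<Longrightarrow> B j \<in> Prol"
  using B_stratum stratum_subset_Prol by blast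

lemma X_in_lie_algebra: "l \<in> {1..int CARD('n)} \<Longrightarrow> X l \<in> \<gg>"
proof -
  assume "l \<in> {1..int CARD('n)}"
  then have "X l \<in> span (\<Union>k\<in>{1..s}. S k)"
    using basis_X unfolding adapted_basis_def by (metis imageI span_base)
  then show "X l \<in> \<gg>" by (simp only: span_S)
qed

text \<open>The weights \<open>g\<close> are the components of \<open>v\<close> in the extremal
  polynomials, and the values of a family at a point in the differential identities; both kinds of
  sums in the statement are instances.\<close>

definition form :: "(int \<Rightarrow> real) \<Rightarrow> (real^'n \<Rightarrow> real^'n) prol \<Rightarrow> real"
  where "form g = coord_form B J g"

lemma form_add: "u \<in> Prol \<Longrightarrow> w \<in> Prol \<Longrightarrow> form g (u + w) = form g u + form g w"
  unfolding form_def by (intro coord_form_add inj_B indep_B) (simp_all add: span_B)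

lemma form_scale: "u \<in> Prol \<Longrightarrow> form g (c *\<^sub>R u) = c * form g u"
  unfolding form_def by (intro coord_form_scale inj_B indep_B) (simp_all add: span_B)

lemma form_B: "j \<in> J \<Longrightarrow> form g (B j) = g j"
  unfolding form_def by (intro coord_form_basis inj_B indep_B)

sublocale extremal_polynomials \<gg> vf_bracket S s idx X "form (ext_vec idx v)"
  by standard (simp_all add: bij_idx X_in_lie_algebra form_add form_scale)

definition supp :: "(real^'n \<Rightarrow> real^'n) prol \<Rightarrow> int set"
  where "supp u = {k. coord B J u k \<noteq> 0}"

lemma supp: "finite (supp u)" "supp u \<subseteq> J"
  unfolding supp_def using finite_coord[OF inj_B indep_B]
  by (auto simp: coord_def split: if_splits)

lemma form_eq_sum: "form g u = (\<Sum>k\<in>supp u. coord B J u k * g k)"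
  unfolding form_def supp_def by (intro coord_form_eq_sum finite_coord inj_B indep_B) simp

lemma form_cong: "(\<And>k. k \<in> J \<Longrightarrow> g k = h k) \<Longrightarrow> form g u = form h u"
  unfolding form_eq_sum using supp(2) by (intro sum.cong) auto

lemma expand_basis: "u \<in> Prol \<Longrightarrow> u = (\<Sum>k\<in>supp u. coord B J u k *\<^sub>R B k)"
  unfolding supp_def using sum_coord[OF inj_B indep_B] span_B by simp

lemma linear_on_Prol_eq_form:
  assumes u: "u \<in> Prol"
    and add: "\<And>u w. u \<in> Prol \<Longrightarrow> w \<in> Prol \<Longrightarrow> f (u + w) = f u + f w"
    and scale: "\<And>c u. u \<in> Prol \<Longrightarrow> f (c *\<^sub>R u) = c * f u"
  shows "f u = form (\<lambda>k. f (B k)) u"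
proof -
  interpret f: extremal_polynomials \<gg> vf_bracket S s idx X f
    by standard (simp_all add: bij_idx X_in_lie_algebra add scale)
  show ?thesis
    using f.lam_sum[of "supp u" B "coord B J u"] supp(2)[of u] B_Prol expand_basis[OF u]
    by (simp add: form_eq_sum subset_iff)
qed

text \<open>In the theorem \<open>u\<close> is \<open>[X i, B j]\<close>, whose coordinates are the
  structure constants: the sum on the right-hand side becomes \<open>EP\<close> of a single
  bracket.\<close>

lemma EP_eq_form: "u \<in> Prol \<Longrightarrow> EP u x = form (\<lambda>k. EP (B k) x) u"
  by (rule linear_on_Prol_eq_form[where f="\<lambda>u. EP u x"]) (rule EP_add EP_scale | assumption)+

lemma iter_bracket_eq_iter:
  assumes "j \<in> J"
  shows "iter_bracket \<gg> vf_bracket idx B j \<alpha> = iter (B j) \<alpha>"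
proof -
  have pow: "((\<lambda>w. prol_bracket \<gg> vf_bracket w (B l)) ^^ k) u = ((\<lambda>w. prol_app w (X l)) ^^ k) u"
    if "l \<in> {1..int CARD('n)}" "u \<in> Prol" for l k u
    using that B_emb
    by (induction k) (simp_all add: prol_bracket_emb_right Prol_funpow X_in_lie_algebra)
  have "foldl (\<lambda>u l. ((\<lambda>w. prol_bracket \<gg> vf_bracket w (B l)) ^^ \<alpha> (idx l)) u) u ls
      = foldl (\<lambda>u l. ((\<lambda>w. prol_app w (X l)) ^^ \<alpha> (idx l)) u) u ls"
    if "set ls \<subseteq> {1..int CARD('n)}" "u \<in> Prol" for u ls
    using that
  proof (induction ls arbitrary: u)
    case (Cons l ls)
    then show ?case using pow[of l u] by (simp add: Prol_funpow)
  qed simp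
  then show ?thesis
    using B_Prol[OF assms] by (simp add: iter_bracket_def iter_def)
qed

lemma extremal_poly_eq_EP:
  assumes "j \<in> J"
  shows "extremal_poly \<gg> vf_bracket idx B J v j = EP (B j)"
proof (rule ext)
  fix x
  have "Sum_any (\<lambda>k. gen_struct_const \<gg> vf_bracket idx B J j \<alpha> k * ext_vec idx v k)
      = form (ext_vec idx v) (iter (B j) \<alpha>)" for \<alpha>
    by (simp only: gen_struct_const_def iter_bracket_eq_iter[OF assms] form_def coord_form_def)
  then show "extremal_poly \<gg> vf_bracket idx B J v j x = EP (B j) x"
    by (simp only: extremal_poly_def EP_def)
qed

lemma struct_const_form:
  assumes i: "i \<in> {1..int CARD('n)}" and j: "j \<in> J"
  shows "Sum_any (\<lambda>k. struct_const \<gg> vf_bracket B J i j k * g k) = form g (- prol_app (B j) (X i))"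
  using B_emb i
  by (simp only: struct_const_def form_def coord_form_def prol_bracket_emb_left B_Prol[OF j] X_in_lie_algebra)

lemma nilpotent_coordinates:
  assumes "nat s \<le> N"
  shows "nilpotent_exponential_coordinates G idx X N"
proof -
  interpret euclidean_lie_group G by standard (rule G)
  show ?thesis
    by standard
      (use assms in \<open>simp_all add: bij_idx X_in_lie_algebra coords subspace_L br_closed funpow_br_eq_0\<close>)
qed

lemma vf_apply_EP:
  assumes u: "u \<in> Prol" and W: "W \<in> \<gg>"
  shows "vf_apply W (EP u) x = - EP (prol_app u W) x"
proof -
  obtain m where "vanishing m u" using Prol_vanishing[OF u] by blast
  \<comment> \<open>\<open>m\<close> bounds the brackets of \<open>u\<close>, \<open>nat s\<close>
    the nilpotency of the Lie algebra. One common order makes the frame of the group and the fold in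
    \<open>EP_axis_derivative\<close> the same term.\<close>
  then have N: "vanishing (max m (nat s)) u" by (rule vanishing_mono) simp
  interpret nilpotent_exponential_coordinates G idx X "max m (nat s)"
    by (rule nilpotent_coordinates) simp
  let ?n = "int CARD('n)"
  have lin: "linear (fd (EP u) x)"
    using smooth_linear_fd smooth_real_polynomial_function real_polynomial_function_EP u by blast
  have Wx: "W = (\<Sum>l=1..?n. (W x $ idx l) *\<^sub>R frame x l)"
    by (rule lie_algebra_frame[OF W])
  then have "W x = (\<Sum>l=1..?n. (W x $ idx l) *\<^sub>R frame x l) x"
    by (rule fun_cong)
  then have "fd (EP u) x (W x) = fd (EP u) x (\<Sum>l=1..?n. (W x $ idx l) *\<^sub>R axis (idx l) 1)"
    by (simp add: sum_fun_apply scaleR_fun_def frame_eq_axis)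
  also have "\<dots> = (\<Sum>l=1..?n. (W x $ idx l) * fd (EP u) x (axis (idx l) 1))"
    by (simp add: linear_sum[OF lin] linear_scale[OF lin])
  also have "\<dots> = (\<Sum>l=1..?n. (W x $ idx l) * - EP (prol_app u (frame x l)) x)"
    by (intro sum.cong refl) (simp only: EP_axis_derivative[OF u N] frame_def)
  also have "\<dots> = - EP (\<Sum>l=1..?n. (W x $ idx l) *\<^sub>R prol_app u (frame x l)) x"
    by (simp add: EP_sum Prol_app u sum_negf)
  also have "(\<Sum>l=1..?n. (W x $ idx l) *\<^sub>R prol_app u (frame x l))
      = prol_app u (\<Sum>l=1..?n. (W x $ idx l) *\<^sub>R frame x l)"
    by (rule Prol_app_sum[OF u frame_closed, symmetric])
  also have "\<dots> = prol_app u W"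
    using Wx by (rule arg_cong[OF sym])
  finally show ?thesis by (simp add: vf_apply_def)
qed

text \<open>The fields annihilating \<open>f\<close> are closed under brackets, so they contain the Lie algebra
  generated by the first stratum.\<close>

lemma constant_if_horizontal_derivatives_zero:
  assumes f: "smooth f" and 0: "\<And>i x. i \<in> {1..int (dim (S 1))} \<Longrightarrow> vf_apply (X i) f x = 0"
  shows "f x = f 0"
proof -
  define V where "V = {W \<in> \<gg>. \<forall>x. vf_apply W f x = 0}"
  have lin: "linear (fd f x)" for x using f by (rule smooth_linear_fd)
  have V: "subspace V"
  proof (rule subspaceI)
    have "vf_apply 0 f x = 0" "vf_apply (W + Z) f x = vf_apply W f x + vf_apply Z f x"
      "vf_apply (c *\<^sub>R W) f x = c * vf_apply W f x" for W Z c x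
      by (simp_all add: vf_apply_def scaleR_fun_def linear_add[OF lin] linear_scale[OF lin] linear_0[OF lin])
    note vf = this
    show "0 \<in> V" "\<And>W Z. W \<in> V \<Longrightarrow> Z \<in> V \<Longrightarrow> W + Z \<in> V" "\<And>c W. W \<in> V \<Longrightarrow> c *\<^sub>R W \<in> V"
      unfolding V_def by (simp_all only: mem_Collect_eq L_closed vf) simp_all
  qed
  have first: "S 1 \<subseteq> V"
  proof -
    have "X ` {1..int (dim (S 1))} \<subseteq> V"
      using adapted_basis_first_stratum(2)[OF basis_X] 0 S_subset_L[of 1] by (auto simp: V_def)
    from span_minimal[OF this V] show ?thesis
      using adapted_basis_first_stratum(1)[OF basis_X] by blast
  qed
  have "1 \<le> i \<Longrightarrow> S i \<subseteq> V" for i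
  proof (induction i rule: int_ge_induct)
    case base
    show ?case by (rule first)
  next
    case (step i)
    have "vf_bracket Y Z \<in> V" if "Y \<in> V" "Z \<in> V" for Y Z
    proof -
      have YZ: "smooth Y" "smooth Z" "Y \<in> \<gg>" "Z \<in> \<gg>" "vf_apply Y f = (\<lambda>_. 0)" "vf_apply Z f = (\<lambda>_. 0)"
        using that lie_algebraD(1) by (auto simp: V_def fun_eq_iff)
      then show ?thesis
        using vf_apply_bracket[OF YZ(1,2) f]
        by (simp add: V_def br_closed) (simp add: vf_apply_def)
    qed
    then have "{vf_bracket Y Z |Y Z. Y \<in> S (i + 1 - 1) \<and> Z \<in> S 1} \<subseteq> V"
      using step.IH first by auto
    then show ?case
      using S_rec[of "i + 1"] step.hyps span_minimal[OF _ V] by simp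
  qed
  then have "(\<Union>i\<in>{1..s}. S i) \<subseteq> V" by fastforce
  then have all: "\<gg> \<subseteq> V"
    using span_minimal[OF _ V] span_S by metis
  interpret nilpotent_exponential_coordinates G idx X "nat s"
    by (rule nilpotent_coordinates) simp
  have "fd f x h = 0" for x h
  proof -
    \<comment> \<open>Every vector at \<open>x\<close> is a combination of values of left-invariant
      fields, so no direction is left out.\<close>
    have h: "h = (\<Sum>l=1..int CARD('n). (h $ idx l) *\<^sub>R frame x l x)"
    proof -
      have "h = (\<Sum>j\<in>UNIV. (h $ j) *\<^sub>R axis j 1)"
        by (simp add: vec_eq_iff axis_def if_distrib cong: if_cong)
      also have "\<dots> = (\<Sum>l=1..int CARD('n). (h $ idx l) *\<^sub>R axis (idx l) 1)"
        by (rule sum.reindex_bij_betw[OF bij_idx, symmetric])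
      finally show ?thesis by (simp add: frame_eq_axis)
    qed
    have "fd f x (frame x l x) = 0" if "l \<in> {1..int CARD('n)}" for l
      using all frame_closed[OF that] by (auto simp: V_def vf_apply_def)
    then show ?thesis
      by (subst h) (simp add: linear_sum[OF lin] linear_scale[OF lin])
  qed
  then have "fd f x = (\<lambda>h. 0)" for x by (rule ext)
  then have "(f has_derivative (\<lambda>h. 0)) (at x)" for x
    using smooth_has_derivative[OF f, of x] by simp
  then obtain c where "f x = c" for x
    using has_derivative_zero_constant[of UNIV f] by auto
  then show ?thesis by simp
qed

lemma real_polynomial_function_form:
  assumes "\<And>j. j \<in> J \<Longrightarrow> real_polynomial_function (Q j)"
  shows "real_polynomial_function (\<lambda>x. form (\<lambda>k. Q k x) u)"
  unfolding form_eq_sum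
  using supp assms by (intro real_polynomial_function_sum real_polynomial_function.intros(2,4)) auto

lemma extremal_poly_unique:
  assumes poly: "\<And>j. j \<in> J \<Longrightarrow> real_polynomial_function (Q j)"
    and der: "\<And>i j x. i \<in> {1..int (dim (S 1))} \<Longrightarrow> j \<in> J \<Longrightarrow>
      vf_apply (X i) (Q j) x = form (\<lambda>k. Q k x) (- prol_app (B j) (X i))"
    and init: "\<And>j. j \<in> J \<Longrightarrow> Q j 0 = ext_vec idx v j"
    and j: "j \<in> J"
  shows "Q j = EP (B j)"
proof -
  \<comment> \<open>\<open>Q\<close> is indexed by the basis; \<open>form\<close> extends it
    linearly to the prolongation, so that brackets with \<open>X i\<close> can be inserted.\<close>
  define E where "E u x = form (\<lambda>k. Q k x) u - EP u x" for u x
  have E_poly: "real_polynomial_function (E u)" if "u \<in> Prol" for u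
    unfolding E_def[abs_def]
    by (intro real_polynomial_function_diff real_polynomial_function_form poly real_polynomial_function_EP that)
  \<comment> \<open>\<open>der\<close> concerns basis elements; both sides are linear in
    \<open>u\<close>, which carries it to the whole prolongation.\<close>
  have der_form: "vf_apply (X i) (\<lambda>x. form (\<lambda>k. Q k x) u) x = form (\<lambda>k. Q k x) (- prol_app u (X i))"
    if i: "i \<in> {1..int (dim (S 1))}" and u: "u \<in> Prol" for i u x
  proof -
    let ?f = "\<lambda>u. form (\<lambda>k. Q k x) (- prol_app u (X i))"
    have "(Q k has_derivative fd (Q k) x) (at x)" if "k \<in> supp u" for k
      using that supp(2) poly differentiable_at_real_polynomial_function frechet_derivative_works by blast
    then have "((\<lambda>x. \<Sum>k\<in>supp u. coord B J u k * Q k x) has_derivative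
        (\<lambda>h. \<Sum>k\<in>supp u. coord B J u k * fd (Q k) x h)) (at x)"
      by (intro has_derivative_sum has_derivative_mult_right)
    then have "vf_apply (X i) (\<lambda>x. form (\<lambda>k. Q k x) u) x = (\<Sum>k\<in>supp u. coord B J u k * vf_apply (X i) (Q k) x)"
      by (simp add: form_eq_sum vf_apply_def fd_eq)
    also have "\<dots> = (\<Sum>k\<in>supp u. coord B J u k * ?f (B k))"
      using supp(2) der[OF i] by (intro sum.cong refl) auto
    also have "\<dots> = form (\<lambda>k. ?f (B k)) u"
      by (rule form_eq_sum[symmetric])
    also have "\<dots> = ?f u"
    proof (rule linear_on_Prol_eq_form[OF u, symmetric])
      fix u w assume u: "u \<in> Prol" and w: "w \<in> Prol"
      have "- prol_app (u + w) (X i) = - prol_app u (X i) + - prol_app w (X i)"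
        by (simp only: prol_app_add minus_add_distrib)
      then show "?f (u + w) = ?f u + ?f w"
        using u w by (simp only: form_add Prol_closed Prol_app)
    next
      fix c u assume u: "u \<in> Prol"
      have "- prol_app (c *\<^sub>R u) (X i) = c *\<^sub>R (- prol_app u (X i))"
        by (simp only: prol_app_scale scaleR_minus_right)
      then show "?f (c *\<^sub>R u) = c * ?f u"
        using u by (simp only: form_scale Prol_closed Prol_app)
    qed
    finally show ?thesis .
  qed
  have E_zero: "E 0 x = 0" for x
    using form_scale[of 0 _ 0] Prol_closed(1) by (simp add: E_def EP_zero)
  have E_minus: "E (- u) x = - E u x" if "u \<in> Prol" for u x
    using form_scale[OF that, of _ "- 1"] by (simp add: E_def EP_minus that)
  have der_E: "vf_apply (X i) (E u) x = - E (prol_app u (X i)) x"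
    if i: "i \<in> {1..int (dim (S 1))}" and u: "u \<in> Prol" for i u x
  proof -
    have X: "X i \<in> \<gg>"
      using adapted_basis_first_stratum(2)[OF basis_X i] S_subset_L[of 1] by auto
    have "vf_apply (X i) (E u) x = vf_apply (X i) (\<lambda>x. form (\<lambda>k. Q k x) u) x - vf_apply (X i) (EP u) x"
      unfolding vf_apply_def E_def[abs_def]
      by (intro fd_diff differentiable_at_real_polynomial_function real_polynomial_function_form poly
          real_polynomial_function_EP u)
    also have "\<dots> = form (\<lambda>k. Q k x) (- prol_app u (X i)) - EP (- prol_app u (X i)) x"
      by (simp only: der_form[OF i u] vf_apply_EP[OF u X] EP_minus Prol_app[OF u])
    also have "\<dots> = - E (prol_app u (X i)) x"
      using E_minus[OF Prol_app[OF u], of "X i" x] by (simp only: E_def)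
    finally show ?thesis .
  qed
  have E_at_0: "E u 0 = 0" if "u \<in> Prol" for u
  proof -
    have "form (\<lambda>k. Q k 0) u = form (ext_vec idx v) u"
      by (rule form_cong) (rule init)
    then show ?thesis by (simp add: E_def EP_at_0 that)
  qed
  have "u \<in> P k \<Longrightarrow> E u x = 0" for u k x
  \<comment> \<open>The measure is \<open>0\<close> exactly for \<open>k > s\<close>, where the
    stratum is zero; a bracket with a field of degree one lowers it by one.\<close>
  proof (induction "nat (s + 1 - k)" arbitrary: u k x)
    case 0
    then have "u = 0" by (simp add: stratum_zero)
    then show ?case by (simp only: E_zero)
  next
    case (Suc m)
    have u: "u \<in> Prol" using Suc.prems stratum_subset_Prol by blast
    have "E (prol_app u (X i)) y = 0" if i: "i \<in> {1..int (dim (S 1))}" for i y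
    proof (rule Suc.hyps(1))
      show "m = nat (s + 1 - (k + 1))" using Suc.hyps(2) by simp
      show "prol_app u (X i) \<in> P (k + 1)"
        using adapted_basis_first_stratum(2)[OF basis_X i] s_ge_1
        by (intro stratum_app[OF Suc.prems]) auto
    qed
    then have "E u x = E u 0"
      using der_E u by (intro constant_if_horizontal_derivatives_zero smooth_real_polynomial_function E_poly) auto
    then show ?case using E_at_0[OF u] by simp
  qed
  then have "E (B j) x = 0" for x
    using B_stratum[OF j] by blast
  then show ?thesis
    using j by (auto simp: E_def form_B fun_eq_iff)
qed

end

theorem theorem2p2:
  fixes G :: "(real^'n::finite) monoid"
    and S :: "int \<Rightarrow> (real^'n \<Rightarrow> real^'n) set"
    and s :: int
    and idx :: "int \<Rightarrow> 'n"
    and X :: "int \<Rightarrow> real^'n \<Rightarrow> real^'n"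
    and J :: "int set"
    and B :: "int \<Rightarrow> (real^'n \<Rightarrow> real^'n) prol"
    and v :: "real^'n"
  assumes "lie_group G"
    and "stratification (lie_algebra G) vf_bracket S s"
    and "adapted_basis {1..s} S {1..int CARD('n)} X"
    and "bij_betw idx {1..int CARD('n)} UNIV"
    and "exp_coordinates_second_type G idx X"
    and "J = {..int CARD('n)} \<or> (\<exists>m. J = {m..int CARD('n)})"
    and "{1..int CARD('n)} \<subseteq> J"
    and "adapted_basis {..s} (prol_stratum (lie_algebra G) vf_bracket S s) J B"
    and "\<forall>j\<in>{1..int CARD('n)}. B j = prol_emb (lie_algebra G) vf_bracket (X j)"
  shows "(\<forall>i\<in>{1..int CARD('n)}. \<forall>j\<in>J. \<forall>x.
            vf_apply (X i) (extremal_poly (lie_algebra G) vf_bracket idx B J v j) x =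
            Sum_any (\<lambda>k. struct_const (lie_algebra G) vf_bracket B J i j k *
                         extremal_poly (lie_algebra G) vf_bracket idx B J v k x))
       \<and> (\<forall>j\<in>J. real_polynomial_function (extremal_poly (lie_algebra G) vf_bracket idx B J v j)
              \<and> extremal_poly (lie_algebra G) vf_bracket idx B J v j 0 = ext_vec idx v j)
       \<and> (\<forall>Q. (\<forall>j\<in>J. real_polynomial_function (Q j)) \<and>
              (\<forall>i\<in>{1..int (dim (S 1))}. \<forall>j\<in>J. \<forall>x.
                 vf_apply (X i) (Q j) x =
                 Sum_any (\<lambda>k. struct_const (lie_algebra G) vf_bracket B J i j k * Q k x)) \<and>
              (\<forall>j\<in>J. Q j 0 = ext_vec idx v j)
              \<longrightarrow> (\<forall>j\<in>J. Q j = extremal_poly (lie_algebra G) vf_bracket idx B J v j))"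
proof -
  interpret tanaka_prolongation G S s idx X J B v
    using assms by unfold_locales
  \<comment> \<open>\<open>form\<close> weighs only indices in \<open>J\<close>, and on these the
    extremal polynomials are the functions \<open>EP (B k)\<close>.\<close>
  have form_EP: "form (\<lambda>k. extremal_poly \<gg> vf_bracket idx B J v k x) u = EP u x" if "u \<in> Prol" for u x
    unfolding EP_eq_form[OF that] by (rule form_cong) (simp only: extremal_poly_eq_EP)
  have "vf_apply (X i) (extremal_poly \<gg> vf_bracket idx B J v j) x =
      Sum_any (\<lambda>k. struct_const \<gg> vf_bracket B J i j k * extremal_poly \<gg> vf_bracket idx B J v k x)"
    if i: "i \<in> {1..int CARD('n)}" and j: "j \<in> J" for i j x
  proof -
    have w: "prol_app (B j) (X i) \<in> Prol" by (intro Prol_app B_Prol j)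
    show ?thesis
      unfolding struct_const_form[OF i j] form_EP[OF Prol_closed(5)[OF w]] EP_minus[OF w]
        extremal_poly_eq_EP[OF j]
      by (rule vf_apply_EP[OF B_Prol[OF j] X_in_lie_algebra[OF i]])
  qed
  moreover have "real_polynomial_function (extremal_poly \<gg> vf_bracket idx B J v j)"
    "extremal_poly \<gg> vf_bracket idx B J v j 0 = ext_vec idx v j" if "j \<in> J" for j
    using that by (simp_all add: extremal_poly_eq_EP real_polynomial_function_EP EP_at_0 B_Prol form_B)
  moreover have "Q j = extremal_poly \<gg> vf_bracket idx B J v j"
    if poly: "\<forall>j\<in>J. real_polynomial_function (Q j)"
      and der: "\<forall>i\<in>{1..int (dim (S 1))}. \<forall>j\<in>J. \<forall>x. vf_apply (X i) (Q j) x =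
        Sum_any (\<lambda>k. struct_const \<gg> vf_bracket B J i j k * Q k x)"
      and init: "\<forall>j\<in>J. Q j 0 = ext_vec idx v j" and j: "j \<in> J" for Q j
    unfolding extremal_poly_eq_EP[OF j]
  proof (rule extremal_poly_unique[OF _ _ _ j])
    fix i k x assume i: "i \<in> {1..int (dim (S 1))}" and k: "k \<in> J"
    have "i \<in> {1..int CARD('n)}"
      using i adapted_basis_first_stratum(2)[OF basis_X i] by simp
    then show "vf_apply (X i) (Q k) x = form (\<lambda>m. Q m x) (- prol_app (B k) (X i))"
      using der i k struct_const_form by simp
  qed (use poly init in auto)
  ultimately show ?thesis by blast
qed

end
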